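(* Let $k\ge1$, $m=2k$, $n\ge 1$, and let $q$ be a nonzero complex number with $q^{8\binom{k}{2}}=1$. In the quantum matrix algebra $M_q(mn)$ put, for $1\le i_1<\cdots<i_m\le mn$, $$[i_1,i_2,\dots,i_m]_m=b_{i_1,i_2,\dots,i_m}=\sum_{i=1}^n\xi^{m(i-1)+1,\dots,mi}_{i_1,\dots,i_m}.$$ Then the quantum hyper-Pfaffian built from these elements satisfies $$[1,2,\dots,mn]_m={\det}_q(a_{ij})_{1\le i,j\le mn}.$$
   Context: $M_q(N)$ is the unital associative complex algebra generated by $a_{ij}$, $1\le i,j\le N$, subject to the relations, for all $i<j$ and $k<l$: $a_{ik}a_{il}=qa_{il}a_{ik}$, $a_{ik}a_{jk}=qa_{jk}a_{ik}$, $a_{jk}a_{il}=a_{il}a_{jk}$, $a_{ik}a_{jl}-a_{jl}a_{ik}=(q-q^{-1})a_{il}a_{jk}$. For $i_1<\cdots<i_s$ and $j_1<\cdots<j_s$ the quantum minor (rows on top, columns below) is $\xi^{i_1,\dots,i_s}_{j_1,\dots,j_s}=\sum_{\sigma\in S_s}(-q)^{l(\sigma)}a_{i_1,j_{\sigma(1)}}\cdots a_{i_s,j_{\sigma(s)}}$, with $l(\sigma)$ the number of inversions; ${\det}_q(a_{ij})_{1\le i,j\le N}=\xi^{1,\dots,N}_{1,\dots,N}$. Quantum hyper-Pfaffian: given elements $b_{i_1,\dots,i_m}$ ($1\le i_1<\cdots<i_m\le mn$) of an associative algebra, put $[i_1,\dots,i_m]_m=b_{i_1,\dots,i_m}$ and,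 for $s_1<\cdots<s_{mp}$ in $\{1,\dots,mn\}$ with $p\ge 2$, inductively $$[s_1,\dots,s_{mp}]_m=\sum_{1<j_2<\cdots<j_m\le mp}(-q)^{\sum_{t=2}^m(j_t-t)}[s_1,s_{j_2},\dots,s_{j_m}]_m\,[s_2,\dots,\widehat{s_{j_2}},\dots,\widehat{s_{j_m}},\dots,s_{mp}]_m$$ (hats mean omitted entries). The quantum hyper-Pfaffian is $[1,2,\dots,mn]_m$. *)

theory Defs
  imports
    Complex_Main
    "HOL-Library.Poly_Mapping"
    "HOL-Combinatorics.Permutations"
    "HOL-Algebra.QuotRing"
    "HOL-Algebra.Module"
begin

section \<open>Complex algebras given by generators and relations\<close>

text \<open>
  Unital associative complex algebras are represented by the record type \<open>(complex, 'a) module\<close>,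
  i.e. a ring record together with a scalar multiplication \<open>\<odot>\<close>. (The locale \<open>algebra\<close> of
  HOL-Algebra requires commutativity and is therefore not used.)
\<close>

datatype 'x fword = FWord (letters: "'x list")

instantiation fword :: (type) monoid_add
begin

definition zero_fword :: "'a fword" where
  "0 = FWord []"

definition plus_fword :: "'a fword \<Rightarrow> 'a fword \<Rightarrow> 'a fword" where
  "u + v = FWord (letters u @ letters v)"

instance
  by standard (simp_all add: zero_fword_def plus_fword_def)

end

text \<open>
  Since concatenation is the addition of words, the convolution product on \<open>'x fword \<Rightarrow>\<^sub>0 complex\<close>
  is the product of noncommutative polynomials.
\<close>

definition free_algebra :: "'x set \<Rightarrow> (complex, 'x fword \<Rightarrow>\<^sub>0 complex) module" where
  "free_algebra X =
    \<lparr>carrier = {f. \<forall>w \<in> Poly_Mapping.keys f. set (letters w) \<subseteq> X},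
     mult = (*), one = 1, zero = 0, add = (+),
     smult = (\<lambda>c f. Poly_Mapping.map (\<lambda>z. c * z) f)\<rparr>"

lemma free_algebra_simps [simp]:
  "carrier (free_algebra X) = {f. \<forall>w \<in> Poly_Mapping.keys f. set (letters w) \<subseteq> X}"
  "mult (free_algebra X) = (*)" "one (free_algebra X) = 1" "zero (free_algebra X) = 0"
  "add (free_algebra X) = (+)" "smult (free_algebra X) = (\<lambda>c f. Poly_Mapping.map (\<lambda>z. c * z) f)"
  by (simp_all add: free_algebra_def)

lemma free_algebra_mult_closed:
  assumes "f \<in> carrier (free_algebra X)" "g \<in> carrier (free_algebra X)"
  shows "f * g \<in> carrier (free_algebra X)"
  using assms keys_mult[of f g] by (fastforce simp: plus_fword_def)

lemma free_algebra_add_closed: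
  assumes "f \<in> carrier (free_algebra X)" "g \<in> carrier (free_algebra X)"
  shows "f + g \<in> carrier (free_algebra X)"
  using assms Poly_Mapping.keys_add[of f g] by fastforce

lemma ring_free_algebra: "ring (free_algebra X)"
proof (rule ringI)
  show "abelian_group (free_algebra X)"
  proof (rule abelian_groupI)
    fix f assume "f \<in> carrier (free_algebra X)"
    then show "\<exists>g\<in>carrier (free_algebra X). g \<oplus>\<^bsub>free_algebra X\<^esub> f = \<zero>\<^bsub>free_algebra X\<^esub>"
      by (intro bexI[of _ "- f"]) auto
  next
    fix f g assume "f \<in> carrier (free_algebra X)" "g \<in> carrier (free_algebra X)"
    then show "f \<oplus>\<^bsub>free_algebra X\<^esub> g \<in> carrier (free_algebra X)"
      by (simp only: free_algebra_simps(5) free_algebra_add_closed)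
  qed (simp_all add: ac_simps)
  show "monoid (free_algebra X)"
  proof (rule monoidI)
    fix f g assume "f \<in> carrier (free_algebra X)" "g \<in> carrier (free_algebra X)"
    then show "f \<otimes>\<^bsub>free_algebra X\<^esub> g \<in> carrier (free_algebra X)"
      by (simp only: free_algebra_simps(2) free_algebra_mult_closed)
  next
    show "\<one>\<^bsub>free_algebra X\<^esub> \<in> carrier (free_algebra X)"
      by (simp add: zero_fword_def)
  qed (simp_all add: mult.assoc)
qed (auto simp: distrib_left distrib_right)

definition free_gen :: "'x \<Rightarrow> ('x fword \<Rightarrow>\<^sub>0 complex)" where
  "free_gen x = Poly_Mapping.single (FWord [x]) 1"

text \<open>
  The cosets of a two-sided ideal \<open>I\<close>; \<open>c \<odot> C\<close> is the coset of \<open>c \<odot> x\<close>, for any \<open>x \<in> C\<close>.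
\<close>

definition quot_algebra :: "(complex, 'a) module \<Rightarrow> 'a set \<Rightarrow> (complex, 'a set) module" where
  "quot_algebra A I =
    ring.extend (A Quot I)
      (module.fields (\<lambda>c C. \<Union>x\<in>C. I +>\<^bsub>A\<^esub> (c \<odot>\<^bsub>A\<^esub> x)))"

lemma quot_algebra_simps:
  "carrier (quot_algebra A I) = carrier (A Quot I)"
  "mult (quot_algebra A I) = mult (A Quot I)" "one (quot_algebra A I) = one (A Quot I)"
  "add (quot_algebra A I) = add (A Quot I)" "zero (quot_algebra A I) = zero (A Quot I)"
  "c \<odot>\<^bsub>quot_algebra A I\<^esub> C = (\<Union>x\<in>C. I +>\<^bsub>A\<^esub> (c \<odot>\<^bsub>A\<^esub> x))"
  by (simp_all add: quot_algebra_def ring.defs module.defs)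

text \<open>
  The ideals of \<open>genideal\<close> are two-sided; as the ring is unital they are closed under
  scalar multiplication.
\<close>

definition presented_algebra ::
    "'x set \<Rightarrow> ('x fword \<Rightarrow>\<^sub>0 complex) set \<Rightarrow> (complex, ('x fword \<Rightarrow>\<^sub>0 complex) set) module" where
  "presented_algebra X R =
    quot_algebra (free_algebra X) (genideal (free_algebra X) R)"

definition presented_gen ::
    "'x set \<Rightarrow> ('x fword \<Rightarrow>\<^sub>0 complex) set \<Rightarrow> 'x \<Rightarrow> ('x fword \<Rightarrow>\<^sub>0 complex) set" where
  "presented_gen X R x =
    genideal (free_algebra X) R +>\<^bsub>free_algebra X\<^esub> free_gen x"

section \<open>The quantum matrix algebra\<close>

text \<open>
  The relation between two entries of one row holds in every row, and the relation between
  two entries of one column holds in every column, including the last ones.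
\<close>

definition qmat_relations :: "complex \<Rightarrow> nat \<Rightarrow> ((nat \<times> nat) fword \<Rightarrow>\<^sub>0 complex) set" where
  "qmat_relations q N =
    (let F = free_algebra ({1..N} \<times> {1..N});
         x = (\<lambda>i j. free_gen (i, j)) in
      {x i k * x i l - q \<odot>\<^bsub>F\<^esub> (x i l * x i k) | i k l.
         i \<in> {1..N} \<and> k \<in> {1..N} \<and> l \<in> {1..N} \<and> k < l}
    \<union> {x i k * x j k - q \<odot>\<^bsub>F\<^esub> (x j k * x i k) | i j k.
         i \<in> {1..N} \<and> j \<in> {1..N} \<and> k \<in> {1..N} \<and> i < j}
    \<union> {x j k * x i l - x i l * x j k | i j k l.
         i \<in> {1..N} \<and> j \<in> {1..N} \<and> k \<in> {1..N} \<and> l \<in> {1..N} \<and> i < j \<and> k < l}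
    \<union> {x i k * x j l - x j l * x i k - (q - inverse q) \<odot>\<^bsub>F\<^esub> (x i l * x j k) | i j k l.
         i \<in> {1..N} \<and> j \<in> {1..N} \<and> k \<in> {1..N} \<and> l \<in> {1..N} \<and> i < j \<and> k < l})"

definition qmat_algebra ::
    "complex \<Rightarrow> nat \<Rightarrow> (complex, ((nat \<times> nat) fword \<Rightarrow>\<^sub>0 complex) set) module" where
  "qmat_algebra q N = presented_algebra ({1..N} \<times> {1..N}) (qmat_relations q N)"

definition qmat_gen ::
    "complex \<Rightarrow> nat \<Rightarrow> nat \<Rightarrow> nat \<Rightarrow> ((nat \<times> nat) fword \<Rightarrow>\<^sub>0 complex) set" where
  "qmat_gen q N i j = presented_gen ({1..N} \<times> {1..N}) (qmat_relations q N) (i, j)"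

lemma qmat_relations_carrier:
  "qmat_relations q N \<subseteq> carrier (free_algebra ({1..N} \<times> {1..N}))" (is "_ \<subseteq> carrier ?F")
proof -
  have gen: "free_gen (i, j) \<in> carrier ?F" if "i \<in> {1..N}" "j \<in> {1..N}" for i j
    using that by (simp add: free_gen_def)
  have sm: "c \<odot>\<^bsub>?F\<^esub> f \<in> carrier ?F" if "f \<in> carrier ?F" for c f
    using that by (auto simp: in_keys_iff map.rep_eq when_def)
  have df: "f - g \<in> carrier ?F" if "f \<in> carrier ?F" "g \<in> carrier ?F" for f g
    using that keys_diff[of f g] by fastforce
  show ?thesis
    unfolding qmat_relations_def Let_def
    by (auto simp del: free_algebra_simps One_nat_def intro!: df sm free_algebra_mult_closed gen)
qed

lemma ring_quot_algebra:
  assumes "ring (A Quot I)"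
  shows "ring (quot_algebra A I)"
proof -
  interpret Q: ring "A Quot I" by (rule assms)
  show ?thesis
  proof (rule ringI)
    show "abelian_group (quot_algebra A I)"
    proof (rule abelian_groupI, unfold quot_algebra_simps)
      show "\<exists>y\<in>carrier (A Quot I). y \<oplus>\<^bsub>A Quot I\<^esub> x = \<zero>\<^bsub>A Quot I\<^esub>"
        if "x \<in> carrier (A Quot I)" for x
        using that Q.l_neg Q.a_inv_closed by blast
    qed (simp_all add: Q.a_ac)
    show "monoid (quot_algebra A I)"
      by (rule monoidI, unfold quot_algebra_simps)
        (simp_all add: Q.m_assoc)
  qed (simp_all add: quot_algebra_simps Q.l_distr Q.r_distr)
qed

lemma ring_qmat_algebra: "ring (qmat_algebra q N)"
  unfolding qmat_algebra_def presented_algebra_def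
  by (intro ring_quot_algebra ideal.quotient_is_ring ring.genideal_ideal ring_free_algebra
    qmat_relations_carrier)

lemma qmat_gen_carrier:
  assumes "i \<in> {1..N}" "j \<in> {1..N}"
  shows "qmat_gen q N i j \<in> carrier (qmat_algebra q N)"
proof -
  have "free_gen (i, j) \<in> carrier (free_algebra ({1..N} \<times> {1..N}))"
    using assms by (simp add: free_gen_def)
  then show ?thesis
    unfolding qmat_gen_def presented_gen_def qmat_algebra_def presented_algebra_def quot_algebra_def
    by (auto simp: ring.defs module.defs FactRing_simps simp del: free_algebra_simps One_nat_def)
qed

section \<open>Quantum minors and the quantum determinant\<close>

definition inversion_number :: "nat \<Rightarrow> (nat \<Rightarrow> nat) \<Rightarrow> nat" where
  "inversion_number s \<sigma> = card {(i, j). i < j \<and> j < s \<and> \<sigma> i > \<sigma> j}"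

definition prod_seq :: "('a, 'b) monoid_scheme \<Rightarrow> 'a list \<Rightarrow> 'a" where
  "prod_seq A xs = foldr (mult A) xs \<one>\<^bsub>A\<^esub>"

text \<open>
  Index sequences are strictly increasing lists. Lists are indexed from 0, so the symmetric
  group acts on \<open>{0..<s}\<close>.
\<close>

definition quantum_minor ::
    "(complex, 'a) module \<Rightarrow> complex \<Rightarrow> (nat \<Rightarrow> nat \<Rightarrow> 'a) \<Rightarrow> nat list \<Rightarrow> nat list \<Rightarrow> 'a" where
  "quantum_minor A q a rows cols =
    (let s = length rows in
      \<Oplus>\<^bsub>A\<^esub> \<sigma> \<in> {\<sigma>. \<sigma> permutes {0..<s}}.
        (- q) ^ inversion_number s \<sigma> \<odot>\<^bsub>A\<^esub>
          prod_seq A (map (\<lambda>r. a (rows ! r) (cols ! \<sigma> r)) [0..<s]))"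

definition quantum_det ::
    "(complex, 'a) module \<Rightarrow> complex \<Rightarrow> (nat \<Rightarrow> nat \<Rightarrow> 'a) \<Rightarrow> nat \<Rightarrow> 'a" where
  "quantum_det A q a N = quantum_minor A q a [1..<Suc N] [1..<Suc N]"

section \<open>Quantum hyper-Pfaffians\<close>

text \<open>
  \<open>hyper_bracket A q m b p [s\<^sub>1, \<dots>, s\<^sub>m\<^sub>p]\<close> is the bracket \<open>[s\<^sub>1, \<dots>, s\<^sub>m\<^sub>p]\<^sub>m\<close>.
  The sum is over the lists \<open>js = [j\<^sub>2, \<dots>, j\<^sub>m]\<close> of 1-based positions; thus \<open>j\<^sub>t = js ! (t - 2)\<close>,
  and \<open>j\<^sub>t \<ge> t\<close>, so that the subtraction \<open>j\<^sub>t - t\<close> is exact.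
  The value for \<open>p = 0\<close> is arbitrary; the recursion ends at \<open>p = 1\<close>.
\<close>

definition bracket_positions :: "nat \<Rightarrow> nat \<Rightarrow> nat list set" where
  "bracket_positions m L =
    {js. length js = m - 1 \<and> sorted_wrt (<) js \<and> set js \<subseteq> {j. 1 < j \<and> j \<le> L}}"

fun hyper_bracket ::
    "(complex, 'a) module \<Rightarrow> complex \<Rightarrow> nat \<Rightarrow> (nat list \<Rightarrow> 'a) \<Rightarrow> nat \<Rightarrow> nat list \<Rightarrow> 'a" where
  "hyper_bracket A q m b 0 s = \<one>\<^bsub>A\<^esub>"
| "hyper_bracket A q m b (Suc 0) s = b s"
| "hyper_bracket A q m b (Suc (Suc p)) s =
    (\<Oplus>\<^bsub>A\<^esub> js \<in> bracket_positions m (m * Suc (Suc p)).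
      (- q) ^ (\<Sum>t = 2..m. js ! (t - 2) - t) \<odot>\<^bsub>A\<^esub>
        (b (map (\<lambda>j. s ! (j - 1)) (1 # js)) \<otimes>\<^bsub>A\<^esub>
         hyper_bracket A q m b (Suc p) (nths s {i. Suc i \<notin> set (1 # js)})))"

definition quantum_hyper_pfaffian ::
    "(complex, 'a) module \<Rightarrow> complex \<Rightarrow> nat \<Rightarrow> nat \<Rightarrow> (nat list \<Rightarrow> 'a) \<Rightarrow> 'a" where
  "quantum_hyper_pfaffian A q m n b = hyper_bracket A q m b n [1..<Suc (m * n)]"

end

theory Submission
  imports Defs "HOL-Combinatorics.Multiset_Permutations"
begin

text \<open>
  Let \<open>x\<^sub>1, x\<^sub>2, \<dots>\<close> generate the quantum exterior algebra, in which \<open>x\<^sub>d x\<^sub>c = -q x\<^sub>c x\<^sub>d\<close> for \<open>c < d\<close> and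
  \<open>x\<^sub>c\<^sup>2 = 0\<close>, and put \<open>y\<^sub>i = \<Sum>\<^sub>c a\<^sub>i\<^sub>c x\<^sub>c\<close>. The coefficients of a product of the \<open>y\<^sub>i\<close> are quantum minors,
  and the \<open>y\<^sub>i\<close> satisfy the relations of the \<open>x\<^sub>i\<close>. Let \<open>\<omega>\<^sub>j\<close> be the product of the \<open>y\<^sub>i\<close> over
  the \<open>j\<close>-th block of \<open>m\<close> rows. By induction on \<open>p\<close>, the bracket of a set \<open>S\<close> of \<open>mp\<close> columns is the
  coefficient of \<open>x\<^sub>S\<close> in \<open>\<Sum> \<omega>\<^sub>j\<^sub>1 \<cdots> \<omega>\<^sub>j\<^sub>p\<close> over \<open>j\<^sub>1 < \<cdots> < j\<^sub>p\<close>; for \<open>p = n\<close> this is the determinant.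

  In the induction step, the least column \<open>s\<close> of \<open>S\<close> is split off the first factor \<open>\<omega>\<^sub>j\<close>. If the entry
  \<open>a\<^sub>r\<^sub>s\<close> is taken from its row \<open>r\<close>, the other \<open>m - 1\<close> rows of the block move past the \<open>c\<close> blocks
  with smaller index, which gives \<open>(-q)\<close> to the power \<open>m (m - 1) c\<close>; expanding the product along its
  first column gives the power \<open>m c\<close> instead. The two agree, as
  \<open>m (m - 2) = 8 (k choose 2)\<close>. If \<open>\<omega>\<^sub>j\<close> already occurs in the second factor, a row is repeated and the term vanishes.
\<close>

section \<open>Quantum minors by expansion along the first row\<close>

text \<open>For disjoint \<open>X\<close> and \<open>Y\<close> this is the exponent of
  \<open>-q\<close> that appears when the ordered monomial of \<open>X\<close> times that of
  \<open>Y\<close> in the \<open>x\<^sub>c\<close> is sorted into the ordered monomial of the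
  union.\<close>

definition inversions :: "nat set \<Rightarrow> nat set \<Rightarrow> nat" where
  "inversions X Y = (\<Sum>x\<in>X. card {y\<in>Y. y < x})"

text \<open>
  Left multiplication by \<open>y\<^sub>i\<close>, where \<open>F\<close> assigns to a set of columns the coefficient of the
  corresponding ordered monomial.
\<close>

definition row_mult ::
    "'r::ring_1 \<Rightarrow> (nat \<Rightarrow> nat \<Rightarrow> 'r) \<Rightarrow> nat \<Rightarrow> (nat set \<Rightarrow> 'r) \<Rightarrow> nat set \<Rightarrow> 'r" where
  "row_mult p a i F C = (\<Sum>c\<in>C. p ^ card {d\<in>C. d < c} * a i c * F (C - {c}))"

text \<open>Rows form a list, since a product of the \<open>y\<^sub>i\<close> depends on their order
  and may repeat a row; columns form a set, since monomials in the \<open>x\<^sub>c\<close> can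
  always be sorted.\<close>

fun row_minor :: "'r::ring_1 \<Rightarrow> (nat \<Rightarrow> nat \<Rightarrow> 'r) \<Rightarrow> nat list \<Rightarrow> nat set \<Rightarrow> 'r" where
  "row_minor p a [] = (\<lambda>C. if C = {} then 1 else 0)"
| "row_minor p a (i # R) = row_mult p a i (row_minor p a R)"

lemma inversions_empty [simp]: "inversions {} Y = 0"
  by (simp add: inversions_def)

lemma inversions_insert_left:
  "finite X \<Longrightarrow> x \<notin> X \<Longrightarrow> inversions (insert x X) Y = card {y\<in>Y. y < x} + inversions X Y"
  by (simp add: inversions_def)

text \<open>The product of the \<open>y\<^sub>i\<close> over \<open>R\<close> is homogeneous of
  degree \<open>length R\<close> in the \<open>x\<^sub>c\<close>.\<close>

lemma row_minor_eq_0: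
  assumes "finite C" "card C \<noteq> length R"
  shows "row_minor p a R C = 0"
  using assms
proof (induction R arbitrary: C)
  case Nil
  then show ?case by auto
next
  case (Cons i R)
  have "row_minor p a R (C - {c}) = 0" if "c \<in> C" for c
    using Cons.prems that card_Suc_Diff1[of C c] by (intro Cons.IH) auto
  then show ?case by (simp add: row_mult_def)
qed

text \<open>The Laplace expansion compares coefficients in a product of two factors; it rests on
  sorting the \<open>x\<^sub>c\<close> alone.\<close>

lemma row_minor_append:
  fixes p :: "'r::ring_1"
  assumes central: "\<And>x. p * x = x * p" and "finite S"
  shows "row_minor p a (R @ R') S =
    (\<Sum>I\<in>Pow S. p ^ inversions I (S - I) * row_minor p a R I * row_minor p a R' (S - I))"
  using \<open>finite S\<close>
proof (induction R arbitrary: S)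
  case Nil
  have "(\<Sum>I\<in>Pow S. p ^ inversions I (S - I) * row_minor p a [] I * row_minor p a R' (S - I))
      = (\<Sum>I\<in>Pow S. if I = {} then row_minor p a R' S else 0)"
    by (rule sum.cong) auto
  then show ?case using Nil by (simp add: sum.delta)
next
  case (Cons i R)
  have pc: "x * p ^ k = p ^ k * x" for x k
    by (rule power_commuting_commutes[OF central, symmetric])
  let ?l = "\<lambda>c C. card {d\<in>C. d < c}"
  have eq: "p ^ ?l c S * a i c * (p ^ inversions J (S - {c} - J) * u * v)
      = p ^ inversions (insert c J) (S - insert c J) * (p ^ ?l c (insert c J) * a i c * u) * v"
    if c: "c \<in> S" and J: "J \<subseteq> S - {c}" for c J u v
  proof -
    have fin: "finite J" using J Cons.prems finite_subset by blast
    have S: "S - {c} - J = S - insert c J" by auto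
    \<comment> \<open>The columns of \<open>S\<close> smaller than \<open>c\<close> are divided
      between the two factors: those in the first give the exponent inside its minor, those in the
      second are the new inversions.\<close>
    have "{d\<in>S. d < c} = {d\<in>insert c J. d < c} \<union> {d\<in>S - insert c J. d < c}"
      using J by auto
    then have l: "?l c S = ?l c (insert c J) + ?l c (S - insert c J)"
      using fin Cons.prems by (simp only:) (subst card_Un_disjoint, auto)
    have "inversions (insert c J) (S - insert c J)
        = ?l c (S - insert c J) + inversions J (S - insert c J)"
      using J fin by (intro inversions_insert_left) auto
    then have "p ^ ?l c S * p ^ inversions J (S - {c} - J)
        = p ^ inversions (insert c J) (S - insert c J) * p ^ ?l c (insert c J)"
      unfolding l S by (simp flip: power_add add: ac_simps)
    moreover have "p ^ ?l c S * a i c * (p ^ inversions J (S - {c} - J) * u * v)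
        = (p ^ ?l c S * p ^ inversions J (S - {c} - J)) * a i c * u * v"
    proof -
      have "a i c * (p ^ inversions J (S - {c} - J) * (u * v))
          = p ^ inversions J (S - {c} - J) * (a i c * (u * v))"
        by (simp only: mult.assoc[symmetric] pc[of "a i c"])
      then show ?thesis by (simp only: mult.assoc)
    qed
    ultimately show ?thesis by (simp add: mult.assoc)
  qed
  have "row_minor p a ((i # R) @ R') S
      = (\<Sum>c\<in>S. \<Sum>J\<in>Pow (S - {c}). p ^ ?l c S * a i c *
          (p ^ inversions J (S - {c} - J) * row_minor p a R J * row_minor p a R' (S - {c} - J)))"
    using Cons by (simp add: row_mult_def sum_distrib_left)
  also have "\<dots> = (\<Sum>(c, J)\<in>Sigma S (\<lambda>c. Pow (S - {c})). p ^ ?l c S * a i c *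
          (p ^ inversions J (S - {c} - J) * row_minor p a R J * row_minor p a R' (S - {c} - J)))"
    using Cons.prems by (subst sum.Sigma) auto
  \<comment> \<open>\<open>I = insert c J\<close> is the column set of the whole first factor, and
    \<open>c\<close> is the column chosen by its first row.\<close>
  also have "\<dots> = (\<Sum>(I, c)\<in>Sigma (Pow S) (\<lambda>I. I). p ^ inversions I (S - I) *
          (p ^ ?l c I * a i c * row_minor p a R (I - {c})) * row_minor p a R' (S - I))"
  proof (rule sum.reindex_bij_witness
      [where i = "\<lambda>(I, c). (c, I - {c})" and j = "\<lambda>(c, J). (insert c J, c)"], goal_cases)
    case (5 x)
    then obtain c J where x: "x = (c, J)" "c \<in> S" "J \<subseteq> S - {c}" by auto
    then have "insert c J - {c} = J" "S - {c} - J = S - insert c J" by auto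
    then show ?case using eq[OF x(2,3)] x(1) by simp
  qed auto
  also have "\<dots> = (\<Sum>I\<in>Pow S. p ^ inversions I (S - I) * row_minor p a (i # R) I *
      row_minor p a R' (S - I))"
    using Cons.prems
    by (subst sum.Sigma[symmetric])
      (auto simp: row_mult_def sum_distrib_left sum_distrib_right intro: finite_subset)
  finally show ?case .
qed

section \<open>The relations between the rows\<close>

lemma sorted_list_of_set_insert_min:
  fixes b :: nat
  assumes "finite A" "\<forall>x\<in>A. b < x"
  shows "sorted_list_of_set (insert b A) = b # sorted_list_of_set A"
proof -
  have "b \<notin> A" using assms by auto
  moreover have "Min (insert b A) = b"
    using assms by (intro Min_eqI) auto
  ultimately show ?thesis
    using sorted_list_of_set_nonempty[of "insert b A"] assms by simp
qed

lemma row_mult_scale: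
  assumes "\<And>x. z * x = x * z"
  shows "row_mult p a i (\<lambda>C. z * F C) C = z * row_mult p a i F C"
proof -
  have "x * (z * y) = z * (x * y)" for x y
    by (metis assms mult.assoc)
  then show ?thesis
    by (simp add: row_mult_def sum_distrib_left mult.assoc)
qed

text \<open>The two ways to distribute columns \<open>c < d\<close> over the rows \<open>i\<close>
  and \<open>j\<close> are collected. The sum of two products of entries is the coefficient of
  \<open>x\<^sub>c x\<^sub>d\<close> in \<open>y\<^sub>i y\<^sub>j\<close>, so relations between two
  rows can be checked on it.\<close>

lemma row_mult_row_mult:
  fixes p :: "'r::ring_1"
  assumes central: "\<And>x. p * x = x * p" and "finite C"
  shows "row_mult p a i (row_mult p a j F) C =
    (\<Sum>(c, d)\<in>{(c, d). c \<in> C \<and> d \<in> C \<and> c < d}.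
      p ^ (card {x\<in>C. x < c} + card {x\<in>C - {c}. x < d}) *
      (a i c * a j d + p * (a i d * a j c)) * F (C - {c} - {d}))"
proof -
  define l where "l = (\<lambda>c C. card {x\<in>C. x < (c::nat)})"
  define A where "A = {(c, d). c \<in> C \<and> d \<in> C \<and> c < d}"
  define f where "f = (\<lambda>(c, d). p ^ l c C * a i c * (p ^ l d (C - {c}) * a j d * F (C - {c} - {d})))"
  have pc: "x * p ^ k = p ^ k * x" for x k
    by (rule power_commuting_commutes[OF central, symmetric])
  have pl: "x * (p ^ k * y) = p ^ k * (x * y)" for x y k
    using pc[of x k] by (metis mult.assoc)
  have "A \<subseteq> C \<times> C" by (auto simp: A_def)
  then have finA: "finite A" using \<open>finite C\<close> finite_subset by blast
  have f: "f (c, d) = p ^ (l c C + l d (C - {c})) * (a i c * a j d) * F (C - {c} - {d})" for c d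
    unfolding f_def by (simp add: power_add mult.assoc pl[of "a i c"])
  have "row_mult p a i (row_mult p a j F) C = (\<Sum>x\<in>Sigma C (\<lambda>c. C - {c}). f x)"
    using \<open>finite C\<close> unfolding f_def
    by (subst sum.Sigma[symmetric]) (simp_all add: row_mult_def l_def sum_distrib_left)
  also have "Sigma C (\<lambda>c. C - {c}) = A \<union> prod.swap ` A"
    by (auto simp: A_def image_iff)
  also have "(\<Sum>x\<in>\<dots>. f x) = (\<Sum>x\<in>A. f x) + (\<Sum>x\<in>A. f (prod.swap x))"
    using finA by (subst sum.union_disjoint) (auto simp: A_def sum.reindex)
  also have "\<dots> = (\<Sum>(c, d)\<in>A. f (c, d) + f (d, c))"
    by (simp add: sum.distrib case_prod_beta prod.swap_def)
  also have "\<dots> = (\<Sum>(c, d)\<in>A. p ^ (l c C + l d (C - {c})) *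
      (a i c * a j d + p * (a i d * a j c)) * F (C - {c} - {d}))"
  proof (rule sum.cong[OF refl], clarify)
    fix c d assume "(c, d) \<in> A"
    then have cd: "c \<in> C" "d \<in> C" "c < d" by (auto simp: A_def)
    \<comment> \<open>Removing \<open>d\<close> first leaves \<open>c\<close> among the columns
      before it, which raises the exponent by one and gives the extra factor
      \<open>p\<close>.\<close>
    have "{x\<in>C. x < d} = insert c {x\<in>C - {c}. x < d}" using cd by auto
    then have "l d C = Suc (l d (C - {c}))" using \<open>finite C\<close> by (simp add: l_def)
    moreover have "{x\<in>C - {d}. x < c} = {x\<in>C. x < c}" using cd by auto
    then have "l c (C - {d}) = l c C" by (simp add: l_def)
    ultimately have e: "l d C + l c (C - {d}) = Suc (l c C + l d (C - {c}))" by simp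
    have s: "C - {d} - {c} = C - {c} - {d}" by auto
    show "f (c, d) + f (d, c) = p ^ (l c C + l d (C - {c})) *
      (a i c * a j d + p * (a i d * a j c)) * F (C - {c} - {d})"
      unfolding f e s
      by (simp add: distrib_left distrib_right mult.assoc power_Suc2 del: power_Suc)
  qed
  finally show ?thesis by (simp add: A_def l_def)
qed

text \<open>
  \<open>p\<close> stands for \<open>-q\<close> and \<open>p'\<close> for its inverse. The algebra is handled through congruence modulo
  an ideal \<open>I\<close> of a subring \<open>K\<close>. The entries \<open>a i j\<close> are total; outside the
  matrix they are set to \<open>0\<close>, so that the relations need no bounds on the indices.
\<close>

locale quantum_matrix_mod =
  fixes K I :: "'r::ring_1 set" and p p' :: 'r and a :: "nat \<Rightarrow> nat \<Rightarrow> 'r"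
  assumes zero_K [simp, intro]: "0 \<in> K" and one_K [simp, intro]: "1 \<in> K"
    and add_K [simp, intro]: "x \<in> K \<Longrightarrow> y \<in> K \<Longrightarrow> x + y \<in> K"
    and mult_K [simp, intro]: "x \<in> K \<Longrightarrow> y \<in> K \<Longrightarrow> x * y \<in> K"
    and zero_I: "0 \<in> I"
    and add_I: "x \<in> I \<Longrightarrow> y \<in> I \<Longrightarrow> x + y \<in> I"
    and uminus_I: "x \<in> I \<Longrightarrow> - x \<in> I"
    and left_I: "x \<in> K \<Longrightarrow> y \<in> I \<Longrightarrow> x * y \<in> I"
    and right_I: "x \<in> K \<Longrightarrow> y \<in> I \<Longrightarrow> y * x \<in> I"
    and p_K [simp, intro]: "p \<in> K" and a_K [simp, intro]: "a i j \<in> K"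
    and central: "p * x = x * p" and inverse: "p * p' = 1"
    and row_relation: "k < l \<Longrightarrow> a i k * a i l + p * (a i l * a i k) \<in> I"
    and commute_relation: "i < j \<Longrightarrow> k < l \<Longrightarrow> a j k * a i l - a i l * a j k \<in> I"
    and cross_relation: "i < j \<Longrightarrow> k < l \<Longrightarrow>
      a i k * a j l - a j l * a i k + (p - p') * (a i l * a j k) \<in> I"
begin

section \<open>Congruence modulo the ideal and the exterior relations between rows\<close>

definition cong :: "'r \<Rightarrow> 'r \<Rightarrow> bool" (infix \<open>\<approx>\<close> 50) where
  "x \<approx> y \<longleftrightarrow> x - y \<in> I"

lemma cong_refl [simp, intro]: "x \<approx> x"
  by (simp add: cong_def zero_I)

lemma cong_sym: "x \<approx> y \<Longrightarrow> y \<approx> x"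
  using uminus_I[of "x - y"] by (simp add: cong_def)

lemma cong_trans [trans]: "x \<approx> y \<Longrightarrow> y \<approx> z \<Longrightarrow> x \<approx> z"
  using add_I[of "x - y" "y - z"] by (simp add: cong_def)

lemma cong_eq_trans [trans]: "x \<approx> y \<Longrightarrow> y = z \<Longrightarrow> x \<approx> z"
  and eq_cong_trans [trans]: "x = y \<Longrightarrow> y \<approx> z \<Longrightarrow> x \<approx> z"
  by simp_all

lemma cong_add: "x \<approx> y \<Longrightarrow> u \<approx> v \<Longrightarrow> x + u \<approx> y + v"
  using add_I[of "x - y" "u - v"] by (simp add: cong_def algebra_simps)

lemma cong_sum: "(\<And>x. x \<in> A \<Longrightarrow> f x \<approx> g x) \<Longrightarrow> sum f A \<approx> sum g A"
  by (induction A rule: infinite_finite_induct) (simp_all add: cong_add)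

lemma cong_mult_left: "z \<in> K \<Longrightarrow> x \<approx> y \<Longrightarrow> z * x \<approx> z * y"
  using left_I[of z "x - y"] by (simp add: cong_def right_diff_distrib)

lemma cong_mult_right: "z \<in> K \<Longrightarrow> x \<approx> y \<Longrightarrow> x * z \<approx> y * z"
  using right_I[of z "x - y"] by (simp add: cong_def left_diff_distrib)

lemma sum_K [intro]: "(\<And>x. x \<in> A \<Longrightarrow> f x \<in> K) \<Longrightarrow> sum f A \<in> K"
  by (induction A rule: infinite_finite_induct) auto

lemma power_K [simp, intro]: "x \<in> K \<Longrightarrow> x ^ n \<in> K"
  by (induction n) auto

lemma power_central: "p ^ n * x = x * p ^ n"
  by (rule power_commuting_commutes[OF central])

lemma entry_left_commute: "a i j * (p ^ n * y) = p ^ n * (a i j * y)"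
  by (simp only: mult.assoc[symmetric] power_central[of n "a i j"])

lemma power_power_commute: "p ^ n * (p ^ k * y) = p ^ k * (p ^ n * y)"
  by (simp add: mult.assoc[symmetric] power_add[symmetric] add.commute)

lemma row_mult_K: "(\<And>c. c \<in> C \<Longrightarrow> F (C - {c}) \<in> K) \<Longrightarrow> row_mult p a i F C \<in> K"
  unfolding row_mult_def by (intro sum_K mult_K) auto

lemma row_minor_K [simp, intro]: "row_minor p a R C \<in> K"
  by (induction R arbitrary: C) (auto intro: row_mult_K)

lemma row_mult_cong:
  "(\<And>c. c \<in> C \<Longrightarrow> F (C - {c}) \<approx> G (C - {c})) \<Longrightarrow> row_mult p a i F C \<approx> row_mult p a i G C"
  unfolding row_mult_def by (intro cong_sum cong_mult_left mult_K) auto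

text \<open>Behind this is \<open>y\<^sub>i\<^sup>2 = 0\<close>: each of its coefficients is an
  instance of \<open>row_relation\<close>.\<close>

lemma row_minor_repeat:
  assumes "finite C"
  shows "row_minor p a (i # i # R) C \<approx> 0"
proof -
  let ?T = "\<lambda>(c, d). p ^ (card {x\<in>C. x < c} + card {x\<in>C - {c}. x < d}) *
      (a i c * a i d + p * (a i d * a i c)) * row_minor p a R (C - {c} - {d})"
  let ?P = "{(c, d). c \<in> C \<and> d \<in> C \<and> c < d}"
  have "row_minor p a (i # i # R) C = sum ?T ?P"
    by (simp add: row_mult_row_mult[OF central assms])
  also have "sum ?T ?P \<approx> (\<Sum>x\<in>?P. 0)"
  proof (intro cong_sum, clarify)
    fix c d :: nat assume "c < d"
    then have "p ^ (card {x\<in>C. x < c} + card {x\<in>C - {c}. x < d}) *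
      (a i c * a i d + p * (a i d * a i c)) * row_minor p a R (C - {c} - {d}) \<in> I"
      by (rule right_I[OF row_minor_K left_I[OF power_K[OF p_K] row_relation]])
    then show "p ^ (card {x\<in>C. x < c} + card {x\<in>C - {c}. x < d}) *
      (a i c * a i d + p * (a i d * a i c)) * row_minor p a R (C - {c} - {d}) \<approx> 0"
      by (simp add: cong_def)
  qed
  finally show ?thesis by simp
qed

text \<open>Behind this is \<open>y\<^sub>j y\<^sub>i = -q y\<^sub>i y\<^sub>j\<close> for
  \<open>i < j\<close>, compared coefficient by coefficient.\<close>

lemma row_minor_swap:
  assumes "finite C" "i < j"
  shows "row_minor p a (j # i # R) C \<approx> p * row_minor p a (i # j # R) C"
proof -
  let ?e = "\<lambda>c d. card {x\<in>C. x < c} + card {x\<in>C - {c}. x < d}"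
  let ?F = "\<lambda>c d. row_minor p a R (C - {c} - {d})"
  let ?P = "{(c, d). c \<in> C \<and> d \<in> C \<and> c < d}"
  have "row_minor p a (j # i # R) C =
      (\<Sum>(c, d)\<in>?P. p ^ ?e c d * (a j c * a i d + p * (a j d * a i c)) * ?F c d)"
    by (simp add: row_mult_row_mult[OF central assms(1)])
  also have "\<dots> \<approx> (\<Sum>(c, d)\<in>?P. p ^ ?e c d * (p * (a i c * a j d + p * (a i d * a j c))) * ?F c d)"
  proof (intro cong_sum, clarify, intro cong_mult_right cong_mult_left)
    fix c d :: nat assume "c < d"
    define X where "X = a j c * a i d - a i d * a j c"
    define D where "D = a i c * a j d - a j d * a i c + (p - p') * (a i d * a j c)"
    have "X \<in> I" "D \<in> I"
      unfolding X_def D_def using assms(2) \<open>c < d\<close>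
      by (auto intro: commute_relation cross_relation)
    \<comment> \<open>\<open>X - p D\<close> is the difference of the two sides: as
      \<open>p p' = 1\<close>, the \<open>p'\<close> term of \<open>p D\<close> cancels the product
      \<open>a i d * a j c\<close> in \<open>X\<close>.\<close>
    then have "X + - (p * D) \<in> I" by (intro add_I uminus_I left_I) auto
    moreover have "p * (p' * z) = z" for z
      by (simp add: mult.assoc[symmetric] inverse)
    then have "X + - (p * D) =
        a j c * a i d + p * (a j d * a i c) - p * (a i c * a j d + p * (a i d * a j c))"
      unfolding X_def D_def by (simp add: algebra_simps)
    ultimately show "a j c * a i d + p * (a j d * a i c) \<approx> p * (a i c * a j d + p * (a i d * a j c))"
      by (simp add: cong_def)
  qed auto
  also have "\<dots> = p * (\<Sum>(c, d)\<in>?P. p ^ ?e c d * (a i c * a j d + p * (a i d * a j c)) * ?F c d)"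
    unfolding sum_distrib_left
    by (intro sum.cong refl) (auto simp: mult.assoc power_power_commute[of _ 1, simplified])
  also have "\<dots> = p * row_minor p a (i # j # R) C"
    by (simp add: row_mult_row_mult[OF central assms(1)])
  finally show ?thesis .
qed

text \<open>The row \<open>x\<close> moves to the right past the smaller rows, each exchange giving
  a factor \<open>p\<close>, and annihilates the product when it meets its own copy.\<close>

lemma row_minor_insort:
  assumes "finite C" "sorted_wrt (<) R"
  shows "row_minor p a (x # R) C \<approx>
    (if x \<in> set R then 0 else p ^ card {y\<in>set R. y < x} * row_minor p a (insort x R) C)"
  using assms
proof (induction R arbitrary: C)
  case Nil
  then show ?case by simp
next
  case (Cons y R)
  consider "x < y" | "x = y" | "y < x" by linarith
  then show ?case
  proof cases
    case 1
    then have empty: "{z\<in>set (y # R). z < x} = {}" and "x \<notin> set (y # R)"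
      using Cons.prems by auto
    then show ?thesis unfolding empty using 1 by simp
  next
    case 2
    then show ?thesis using row_minor_repeat[OF Cons.prems(1)] by simp
  next
    case 3
    let ?G = "\<lambda>C. if x \<in> set R then 0
      else p ^ card {y\<in>set R. y < x} * row_minor p a (insort x R) C"
    have "row_minor p a (x # y # R) C \<approx> p * row_minor p a (y # x # R) C"
      using row_minor_swap Cons.prems 3 by blast
    also have "\<dots> \<approx> p * row_mult p a y ?G C"
      unfolding row_minor.simps(2)[of p a y] using Cons.prems
      by (intro cong_mult_left row_mult_cong Cons.IH) auto
    also have "p * row_mult p a y ?G C = (if x \<in> set (y # R) then 0
        else p ^ card {z\<in>set (y # R). z < x} * row_minor p a (insort x (y # R)) C)"
    proof (cases "x \<in> set R")
      case True
      then show ?thesis by (simp add: row_mult_def)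
    next
      case False
      have "{z\<in>set (y # R). z < x} = insert y {z\<in>set R. z < x}" using 3 by auto
      moreover have "y \<notin> set R" using Cons.prems by auto
      ultimately have "card {z\<in>set (y # R). z < x} = Suc (card {z\<in>set R. z < x})" by simp
      then show ?thesis using False 3
        by (simp add: row_mult_scale[OF power_central] mult.assoc)
    qed
    finally show ?thesis .
  qed
qed

section \<open>Merging sorted products of rows, and expansion along the first column\<close>

abbreviation set_minor :: "nat set \<Rightarrow> nat set \<Rightarrow> 'r" where
  "set_minor X \<equiv> row_minor p a (sorted_list_of_set X)"

lemma set_minor_insert:
  assumes "finite X" "finite C"
  shows "row_minor p a (b # sorted_list_of_set X) C \<approx>
    (if b \<in> X then 0 else p ^ card {x\<in>X. x < b} * set_minor (insert b X) C)"
  using row_minor_insort[of C "sorted_list_of_set X" b] assms by (cases "b \<in> X") simp_all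

text \<open>The rows of \<open>X\<close> are moved into \<open>Y\<close> one at a time, the largest
  first; each passes exactly the smaller rows of \<open>Y\<close>, and a common row annihilates the
  product.\<close>

lemma row_minor_merge:
  assumes "finite X" "finite Y" "finite C"
  shows "row_minor p a (sorted_list_of_set X @ sorted_list_of_set Y) C \<approx>
    (if X \<inter> Y = {} then p ^ inversions X Y * set_minor (X \<union> Y) C else 0)"
  using assms
proof (induction X arbitrary: C rule: finite_linorder_min_induct)
  case empty
  then show ?case by simp
next
  case (insert b X)
  have sorted: "sorted_list_of_set (insert b X) = b # sorted_list_of_set X"
    using insert by (intro sorted_list_of_set_insert_min) auto
  let ?G = "\<lambda>C. if X \<inter> Y = {} then p ^ inversions X Y * set_minor (X \<union> Y) C else 0"
  have "row_minor p a (sorted_list_of_set (insert b X) @ sorted_list_of_set Y) C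
      = row_mult p a b (row_minor p a (sorted_list_of_set X @ sorted_list_of_set Y)) C"
    unfolding sorted by simp
  also have "\<dots> \<approx> row_mult p a b ?G C"
    using insert by (intro row_mult_cong) auto
  also have "\<dots> \<approx> (if insert b X \<inter> Y = {} then
      p ^ inversions (insert b X) Y * set_minor (insert b X \<union> Y) C else 0)"
  proof (cases "X \<inter> Y = {}")
    case False
    then show ?thesis by (simp add: row_mult_def)
  next
    case True
    have b: "b \<notin> X" using insert by auto
    \<comment> \<open>All rows of \<open>X\<close> exceed \<open>b\<close>, so in the merged product
      \<open>b\<close> passes only rows of \<open>Y\<close>.\<close>
    have "{y\<in>X \<union> Y. y < b} = {y\<in>Y. y < b}" "b \<in> X \<union> Y \<longleftrightarrow> b \<in> Y" using insert by auto
    then have "row_minor p a (b # sorted_list_of_set (X \<union> Y)) C \<approx>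
      (if b \<in> Y then 0 else p ^ card {y\<in>Y. y < b} * set_minor (insert b (X \<union> Y)) C)"
      using set_minor_insert[of "X \<union> Y" C b] insert by (simp only: finite_Un)
    then have "p ^ inversions X Y * row_minor p a (b # sorted_list_of_set (X \<union> Y)) C \<approx>
      p ^ inversions X Y * (if b \<in> Y then 0
        else p ^ card {y\<in>Y. y < b} * set_minor (insert b (X \<union> Y)) C)"
      by (intro cong_mult_left) auto
    also have "\<dots> = (if insert b X \<inter> Y = {} then
      p ^ inversions (insert b X) Y * set_minor (insert b X \<union> Y) C else 0)"
      using True b insert
      by (simp add: inversions_insert_left mult.assoc[symmetric] power_add[symmetric] add.commute)
    finally show ?thesis
      using True by (simp add: row_mult_scale[OF power_central])
  qed
  finally show ?case .
qed

text \<open>Minors are defined by expansion along the first row, so in an induction on the rows the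
  entry of column \<open>s\<close> has to move left past entries of smaller rows and larger columns.
  By \<open>commute_relation\<close> it commutes with them.\<close>

lemma set_minor_expand_min:
  assumes "finite X" "finite C" "\<forall>c\<in>C. s < c"
  shows "set_minor X (insert s C) \<approx>
    (\<Sum>r\<in>X. p ^ card {x\<in>X. x < r} * a r s * set_minor (X - {r}) C)"
  using assms
proof (induction X arbitrary: C rule: finite_linorder_min_induct)
  case empty
  then show ?case by simp
next
  case (insert b X)
  have s: "s \<notin> C" and b: "b \<notin> X" using insert by auto
  have sorted: "sorted_list_of_set (insert b Z) = b # sorted_list_of_set Z" if "Z \<subseteq> X" for Z
    using insert that by (intro sorted_list_of_set_insert_min) (auto intro: finite_subset)
  let ?l = "\<lambda>r X. card {x\<in>X. x < r}"
  have ls: "?l s (insert s C) = 0" and lb: "?l b (insert b X) = 0"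
    using insert by auto
  have lC: "?l c (insert s C) = Suc (?l c C)" if "c \<in> C" for c
  proof -
    have "{x\<in>insert s C. x < c} = insert s {x\<in>C. x < c}" using that insert by auto
    then show ?thesis using s insert by simp
  qed
  have lX: "?l r (insert b X) = Suc (?l r X)" if "r \<in> X" for r
  proof -
    have "{x\<in>insert b X. x < r} = insert b {x\<in>X. x < r}" using that insert by auto
    then show ?thesis using b insert by simp
  qed
  have "set_minor (insert b X) (insert s C) = row_mult p a b (set_minor X) (insert s C)"
    by (simp only: sorted row_minor.simps order.refl)
  also have "\<dots> = a b s * set_minor X C +
      (\<Sum>c\<in>C. p ^ Suc (?l c C) * a b c * set_minor X (insert s (C - {c})))"
  proof -
    have "insert s C - {c} = insert s (C - {c})" if "c \<in> C" for c using s that by auto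
    then have "(\<Sum>c\<in>C. p ^ ?l c (insert s C) * a b c * set_minor X (insert s C - {c})) =
        (\<Sum>c\<in>C. p ^ Suc (?l c C) * a b c * set_minor X (insert s (C - {c})))"
      by (intro sum.cong refl) (simp only: lC)
    moreover have "insert s C - {s} = C" using s by auto
    ultimately show ?thesis
      unfolding row_mult_def sum.insert[OF \<open>finite C\<close> s] ls by simp
  qed
  also have "\<dots> \<approx> a b s * set_minor X C + (\<Sum>c\<in>C. p ^ Suc (?l c C) * a b c *
      (\<Sum>r\<in>X. p ^ ?l r X * a r s * set_minor (X - {r}) (C - {c})))"
    using insert by (intro cong_add cong_sum cong_mult_left insert.IH) auto
  \<comment> \<open>The extra factor \<open>p\<close>, which came from column \<open>s\<close>
    preceding \<open>c\<close>, is from here on counted for row \<open>b\<close> preceding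
    \<open>r\<close>.\<close>
  also have "\<dots> = a b s * set_minor X C + (\<Sum>r\<in>X. \<Sum>c\<in>C. p ^ Suc (?l r X) * p ^ ?l c C *
      (a b c * a r s) * set_minor (X - {r}) (C - {c}))"
    unfolding sum_distrib_left
    by (subst sum.swap)
      (simp add: mult.assoc entry_left_commute power_power_commute
        power_power_commute[of _ 1, simplified])
  also have "\<dots> \<approx> a b s * set_minor X C + (\<Sum>r\<in>X. \<Sum>c\<in>C. p ^ Suc (?l r X) * p ^ ?l c C *
      (a r s * a b c) * set_minor (X - {r}) (C - {c}))"
  proof (rule cong_add[OF cong_refl], intro cong_sum)
    fix r c assume "r \<in> X" "c \<in> C"
    then have "b < r" "s < c" using insert.hyps insert.prems by auto
    then have comm: "a b c * a r s \<approx> a r s * a b c"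
      using commute_relation[of b r s c] cong_sym[of "a r s * a b c" "a b c * a r s"]
      by (simp add: cong_def)
    show "p ^ Suc (?l r X) * p ^ ?l c C * (a b c * a r s) * set_minor (X - {r}) (C - {c})
        \<approx> p ^ Suc (?l r X) * p ^ ?l c C * (a r s * a b c) * set_minor (X - {r}) (C - {c})"
      by (rule cong_mult_right[OF row_minor_K cong_mult_left[OF _ comm]]) (rule mult_K power_K p_K)+
  qed
  also have "\<dots> = a b s * set_minor X C +
      (\<Sum>r\<in>X. p ^ Suc (?l r X) * a r s * row_mult p a b (set_minor (X - {r})) C)"
    unfolding row_mult_def sum_distrib_left
    by (simp add: mult.assoc entry_left_commute del: power_Suc)
  also have "\<dots> = (\<Sum>r\<in>insert b X. p ^ ?l r (insert b X) * a r s * set_minor (insert b X - {r}) C)"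
  proof -
    have "row_mult p a b (set_minor (X - {r})) C = set_minor (insert b X - {r}) C" if "r \<in> X" for r
    proof -
      have "insert b X - {r} = insert b (X - {r})" using b that by auto
      moreover have "X - {r} \<subseteq> X" by auto
      ultimately show ?thesis by (simp only: sorted row_minor.simps)
    qed
    then have "(\<Sum>r\<in>X. p ^ Suc (?l r X) * a r s * row_mult p a b (set_minor (X - {r})) C) =
        (\<Sum>r\<in>X. p ^ ?l r (insert b X) * a r s * set_minor (insert b X - {r}) C)"
      by (intro sum.cong refl) (simp only: lX)
    moreover have "insert b X - {b} = X" using b by auto
    ultimately show ?thesis
      unfolding sum.insert[OF \<open>finite X\<close> b] lb by simp
  qed
  finally show ?case .
qed

end

section \<open>Sums over blocks of rows\<close>

text \<open>The half-open form makes the sorted list of a block the very list of rows used in the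
  theorem. Block \<open>0\<close> is empty, hence the assumptions that indices are at least
  \<open>1\<close>.\<close>

definition block :: "nat \<Rightarrow> nat \<Rightarrow> nat set" where
  "block m j = {m * (j - 1) + 1..<Suc (m * j)}"

lemma finite_block [simp]: "finite (block m j)"
  by (simp add: block_def)

lemma card_block: "j \<ge> 1 \<Longrightarrow> card (block m j) = m"
  by (cases j) (simp_all add: block_def)

lemma block_less: "i < j \<Longrightarrow> x \<in> block m i \<Longrightarrow> y \<in> block m j \<Longrightarrow> x < y"
proof -
  assume "i < j" and x: "x \<in> block m i" and y: "y \<in> block m j"
  have "x \<le> m * i" using x by (simp add: block_def)
  also have "\<dots> \<le> m * (j - 1)" using \<open>i < j\<close> by (intro mult_le_mono) auto
  also have "\<dots> < y" using y by (simp add: block_def)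
  finally show "x < y" .
qed

lemma block_disjoint: "i \<noteq> j \<Longrightarrow> block m i \<inter> block m j = {}"
  using block_less[of i j _ m] block_less[of j i _ m] by (cases i j rule: linorder_cases) fastforce+

lemma card_UN_block: "finite T \<Longrightarrow> \<forall>j\<in>T. j \<ge> 1 \<Longrightarrow> card (\<Union>j\<in>T. block m j) = m * card T"
  by (subst card_UN_disjoint) (auto simp: block_disjoint card_block)

lemma UN_block_atMost: "(\<Union>j\<in>{1..n}. block m j) = {1..<Suc (m * n)}"
proof (induction n)
  case (Suc n)
  have "{1..Suc n} = insert (Suc n) {1..n}" by auto
  then show ?case
    using Suc by (auto simp: block_def)
qed simp

text \<open>A block other than that of \<open>x\<close> lies entirely before or entirely after
  \<open>x\<close>.\<close>

lemma UN_block_below: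
  assumes "j \<notin> T" "x \<in> block m j"
  shows "{y\<in>(\<Union>i\<in>T. block m i). y < x} = (\<Union>i\<in>{i\<in>T. i < j}. block m i)"
proof -
  have "y < x \<longleftrightarrow> i < j" if "i \<in> T" "y \<in> block m i" for i y
    using that assms block_less[of i j y m x] block_less[of j i x m y]
    by (cases i j rule: linorder_cases) auto
  then show ?thesis by auto
qed

lemma card_UN_block_below:
  assumes "finite T" "\<forall>i\<in>T. i \<ge> 1" "j \<notin> T" "x \<in> block m j"
  shows "card {y\<in>(\<Union>i\<in>T. block m i). y < x} = m * card {i\<in>T. i < j}"
  unfolding UN_block_below[OF assms(3,4)] using assms by (intro card_UN_block) auto

section \<open>Sums over sets of blocks and the recursion of the bracket\<close>

context quantum_matrix_mod
begin

definition block_sum :: "nat \<Rightarrow> nat \<Rightarrow> nat set \<Rightarrow> 'r" where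
  "block_sum m n C = (\<Sum>j\<in>{1..n}. set_minor (block m j) C)"

text \<open>Blocks with increasing indices follow each other in order, so the product of the
  \<open>\<omega>\<^sub>j\<close> over \<open>T\<close> is the ordered product of the
  \<open>y\<^sub>i\<close> over the union of these blocks.\<close>

definition blocks_sum :: "nat \<Rightarrow> nat \<Rightarrow> nat \<Rightarrow> nat set \<Rightarrow> 'r" where
  "blocks_sum m n k C =
    (\<Sum>T\<in>{T. T \<subseteq> {1..n} \<and> card T = k}. set_minor (\<Union>j\<in>T. block m j) C)"

lemma block_sum_K [simp, intro]: "block_sum m n C \<in> K"
  by (auto simp: block_sum_def)

lemma blocks_sum_K [simp, intro]: "blocks_sum m n k C \<in> K"
  by (auto simp: blocks_sum_def)

lemma block_sum_eq_0: "finite C \<Longrightarrow> card C \<noteq> m \<Longrightarrow> block_sum m n C = 0"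
  unfolding block_sum_def by (intro sum.neutral) (auto intro: row_minor_eq_0 simp: card_block)

lemma blocks_sum_1: "blocks_sum m n (Suc 0) C = block_sum m n C"
proof -
  have "{T. T \<subseteq> {1..n} \<and> card T = Suc 0} = (\<lambda>j. {j}) ` {1..n}"
    by (auto simp: card_Suc_eq)
  then show ?thesis
    by (simp add: blocks_sum_def block_sum_def sum.reindex)
qed

lemma blocks_sum_all: "blocks_sum m n n C = row_minor p a [1..<Suc (m * n)] C"
proof -
  have "{T. T \<subseteq> {1..n} \<and> card T = n} = {{1..n}}"
    using card_subset_eq[of "{1..n}"] by auto
  then have "blocks_sum m n n C = set_minor (\<Union>j\<in>{1..n}. block m j) C"
    by (simp add: blocks_sum_def)
  then show ?thesis
    by (simp only: UN_block_atMost sorted_list_of_set_range)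
qed

text \<open>Moving \<open>m - 1\<close> rows past a block of \<open>m\<close> rows gives
  \<open>m (m - 1)\<close> factors \<open>p\<close>. The hypothesis on \<open>p\<close> trades them
  for \<open>m\<close> factors, one for each row by which this block precedes \<open>r\<close> in
  the union.\<close>

lemma block_merge:
  assumes m: "m \<ge> 2" and p: "p ^ (m * (m - 1)) = p ^ m"
    and T: "finite T" "\<forall>i\<in>T. i \<ge> 1" and j: "j \<ge> 1" and r: "r \<in> block m j" and C: "finite C"
  shows "row_minor p a (sorted_list_of_set (block m j - {r}) @
      sorted_list_of_set (\<Union>i\<in>T. block m i)) C \<approx>
    (if j \<in> T then 0
     else p ^ (m * card {i\<in>T. i < j}) * set_minor ((\<Union>i\<in>insert j T. block m i) - {r}) C)"
proof -
  let ?U = "\<Union>i\<in>T. block m i"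
  have card: "card (block m j - {r}) = m - 1"
    using r j by (simp add: card_block)
  have "row_minor p a (sorted_list_of_set (block m j - {r}) @ sorted_list_of_set ?U) C \<approx>
    (if (block m j - {r}) \<inter> ?U = {}
     then p ^ inversions (block m j - {r}) ?U * set_minor ((block m j - {r}) \<union> ?U) C else 0)"
    using T C by (intro row_minor_merge) auto
  also have "\<dots> = (if j \<in> T then 0
     else p ^ (m * card {i\<in>T. i < j}) * set_minor ((\<Union>i\<in>insert j T. block m i) - {r}) C)"
  proof (cases "j \<in> T")
    case True
    \<comment> \<open>As \<open>m \<ge> 2\<close>, block \<open>j\<close> keeps a row besides
      \<open>r\<close>, and that row occurs in both factors.\<close>
    have "card (block m j - {r}) \<noteq> 0" using card m by simp
    then have "block m j - {r} \<noteq> {}" by (metis card.empty)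
    then have "(block m j - {r}) \<inter> ?U \<noteq> {}" using True by auto
    then show ?thesis using True by simp
  next
    case False
    have dis: "block m j \<inter> block m i = {}" if "i \<in> T" for i
      using that False by (intro block_disjoint) auto
    then have disj: "(block m j - {r}) \<inter> ?U = {}" by auto
    have "r \<notin> ?U" using r dis by auto
    then have union: "(block m j - {r}) \<union> ?U = (\<Union>i\<in>insert j T. block m i) - {r}" by auto
    have "inversions (block m j - {r}) ?U = (\<Sum>x\<in>block m j - {r}. m * card {i\<in>T. i < j})"
      unfolding inversions_def using T False
      by (intro sum.cong refl card_UN_block_below) auto
    also have "\<dots> = (m * (m - 1)) * card {i\<in>T. i < j}" by (simp add: card)
    finally have "p ^ inversions (block m j - {r}) ?U = p ^ (m * card {i\<in>T. i < j})"
      by (metis p power_mult)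
    then show ?thesis using False disj union by simp
  qed
  finally show ?thesis .
qed

text \<open>A set with \<open>Suc k\<close> elements arises once for each of its elements
  \<open>j\<close>, from the set without \<open>j\<close>.\<close>

lemma sum_insert_subsets:
  fixes g :: "nat \<Rightarrow> nat set \<Rightarrow> 'r"
  assumes "finite A"
  shows "(\<Sum>j\<in>A. \<Sum>T\<in>{T. T \<subseteq> A \<and> card T = k}. if j \<in> T then 0 else g j (insert j T)) =
    (\<Sum>T\<in>{T. T \<subseteq> A \<and> card T = Suc k}. \<Sum>j\<in>T. g j T)"
proof -
  let ?S = "\<lambda>k. {T. T \<subseteq> A \<and> card T = k}"
  have fin: "finite (?S k)" for k using assms by simp
  have finT: "finite T" if "T \<subseteq> A" for T using assms that finite_subset by blast
  have "(\<Sum>j\<in>A. \<Sum>T\<in>?S k. if j \<in> T then 0 else g j (insert j T)) =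
    (\<Sum>j\<in>A. \<Sum>T\<in>{T\<in>?S k. j \<notin> T}. g j (insert j T))"
    using fin by (intro sum.cong refl sum.mono_neutral_cong_right) auto
  also have "\<dots> = (\<Sum>(j, T)\<in>Sigma A (\<lambda>j. {T\<in>?S k. j \<notin> T}). g j (insert j T))"
    using assms fin by (intro sum.Sigma) auto
  also have "\<dots> = (\<Sum>(T, j)\<in>Sigma (?S (Suc k)) (\<lambda>T. T). g j T)"
    by (rule sum.reindex_bij_witness
        [where i = "\<lambda>(T, j). (j, T - {j})" and j = "\<lambda>(j, T). (insert j T, j)"])
      (auto simp: finT insert_absorb)
  also have "\<dots> = (\<Sum>T\<in>?S (Suc k). \<Sum>j\<in>T. g j T)"
    using fin finT by (intro sum.Sigma[symmetric]) auto
  finally show ?thesis .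
qed

text \<open>Column \<open>s\<close> is the least and belongs to the first factor, so it enters no
  inversion and the exponent involves only \<open>I\<close> and \<open>C - I\<close>. The expansion
  along column \<open>s\<close> is used twice: forwards on a single block and backwards on a union
  of blocks.\<close>

lemma blocks_sum_Suc:
  assumes m: "m \<ge> 2" and p: "p ^ (m * (m - 1)) = p ^ m"
    and C: "finite C" "\<forall>c\<in>C. s < c"
  shows "(\<Sum>I\<in>Pow C. p ^ inversions I (C - I) * block_sum m n (insert s I) *
      blocks_sum m n k (C - I)) \<approx> blocks_sum m n (Suc k) (insert s C)"
proof -
  let ?S = "\<lambda>k. {T. T \<subseteq> {1..n} \<and> card T = k}"
  let ?U = "\<lambda>T. \<Union>j\<in>T. block m j"
  let ?l = "\<lambda>r X. card {x\<in>X. x < r}"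
  let ?f = "\<lambda>j r. p ^ ?l r (block m j) * a r s"
  have finT: "finite T" "\<forall>i\<in>T. i \<ge> 1" if "T \<in> ?S k" for T k
    using that finite_subset by auto
  have "(\<Sum>I\<in>Pow C. p ^ inversions I (C - I) * block_sum m n (insert s I) * blocks_sum m n k (C - I))
    \<approx> (\<Sum>I\<in>Pow C. p ^ inversions I (C - I) *
      (\<Sum>j\<in>{1..n}. \<Sum>r\<in>block m j. ?f j r * set_minor (block m j - {r}) I) *
      blocks_sum m n k (C - I))"
    unfolding block_sum_def using C
    by (intro cong_sum cong_mult_left cong_mult_right set_minor_expand_min)
      (auto intro: finite_subset)
  also have "\<dots> = (\<Sum>I\<in>Pow C. \<Sum>j\<in>{1..n}. \<Sum>T\<in>?S k. \<Sum>r\<in>block m j. ?f j r *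
      (p ^ inversions I (C - I) * set_minor (block m j - {r}) I * set_minor (?U T) (C - I)))"
    unfolding blocks_sum_def sum_distrib_left sum_distrib_right
    by (intro sum.cong refl, subst sum.swap, intro sum.cong refl)
      (simp add: mult.assoc entry_left_commute power_power_commute)
  also have "\<dots> = (\<Sum>j\<in>{1..n}. \<Sum>T\<in>?S k. \<Sum>r\<in>block m j. \<Sum>I\<in>Pow C. ?f j r *
      (p ^ inversions I (C - I) * set_minor (block m j - {r}) I * set_minor (?U T) (C - I)))"
    by (subst sum.swap, rule sum.cong[OF refl], subst sum.swap, rule sum.cong[OF refl], rule sum.swap)
  \<comment> \<open>The Laplace expansion is read backwards: the sum over \<open>I\<close> is a
    minor of the concatenated rows.\<close>
  also have "\<dots> = (\<Sum>j\<in>{1..n}. \<Sum>T\<in>?S k. \<Sum>r\<in>block m j. ?f j r *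
      row_minor p a (sorted_list_of_set (block m j - {r}) @ sorted_list_of_set (?U T)) C)"
    by (simp only: row_minor_append[OF central C(1)] sum_distrib_left)
  also have "\<dots> \<approx> (\<Sum>j\<in>{1..n}. \<Sum>T\<in>?S k. \<Sum>r\<in>block m j. ?f j r *
      (if j \<in> T then 0 else p ^ (m * card {i\<in>T. i < j}) * set_minor (?U (insert j T) - {r}) C))"
  proof (intro cong_sum, rule cong_mult_left)
    fix j T r assume j: "j \<in> {1..n}" and T: "T \<in> ?S k" and r: "r \<in> block m j"
    show "row_minor p a (sorted_list_of_set (block m j - {r}) @ sorted_list_of_set (?U T)) C \<approx>
      (if j \<in> T then 0 else p ^ (m * card {i\<in>T. i < j}) * set_minor (?U (insert j T) - {r}) C)"
      using j by (intro block_merge[OF m p finT[OF T] _ r C(1)]) simp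
  qed auto
  also have "\<dots> = (\<Sum>j\<in>{1..n}. \<Sum>T\<in>?S k. if j \<in> T then 0 else
      \<Sum>r\<in>block m j. p ^ ?l r (?U (insert j T)) * a r s * set_minor (?U (insert j T) - {r}) C)"
  proof (intro sum.cong refl)
    fix j T assume j: "j \<in> {1..n}" and T: "T \<in> ?S k"
    \<comment> \<open>The rows before \<open>r\<close> in the union are those of its own block and
      all rows of the blocks with smaller index; so the two powers of \<open>p\<close> combine to
      the exponent of the expansion of the union.\<close>
    have l: "?l r (?U (insert j T)) = ?l r (block m j) + m * card {i\<in>T. i < j}"
      if "j \<notin> T" "r \<in> block m j" for r
    proof -
      have "block m j \<inter> block m i = {}" if "i \<in> T" for i
        using that \<open>j \<notin> T\<close> by (intro block_disjoint) auto
      then have "?l r (?U (insert j T)) = ?l r (block m j) + card {y\<in>?U T. y < r}"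
        using finT[OF T] by (subst card_Un_disjoint[symmetric]) (auto intro!: arg_cong[of _ _ card])
      then show ?thesis using card_UN_block_below[of T j r m] finT[OF T] that by simp
    qed
    show "(\<Sum>r\<in>block m j. ?f j r * (if j \<in> T then 0
        else p ^ (m * card {i\<in>T. i < j}) * set_minor (?U (insert j T) - {r}) C)) =
      (if j \<in> T then 0 else
        \<Sum>r\<in>block m j. p ^ ?l r (?U (insert j T)) * a r s * set_minor (?U (insert j T) - {r}) C)"
    proof (cases "j \<in> T")
      case False
      show ?thesis unfolding if_not_P[OF False]
        by (intro sum.cong refl)
          (simp only: l[OF False] power_add mult.assoc entry_left_commute)
    qed simp
  qed
  also have "\<dots> = (\<Sum>T\<in>?S (Suc k). \<Sum>j\<in>T. \<Sum>r\<in>block m j.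
      p ^ ?l r (?U T) * a r s * set_minor (?U T - {r}) C)"
    by (rule sum_insert_subsets) simp
  also have "\<dots> = (\<Sum>T\<in>?S (Suc k). \<Sum>r\<in>?U T. p ^ ?l r (?U T) * a r s * set_minor (?U T - {r}) C)"
  proof (rule sum.cong[OF refl])
    fix T assume T: "T \<in> ?S (Suc k)"
    show "(\<Sum>j\<in>T. \<Sum>r\<in>block m j. p ^ ?l r (?U T) * a r s * set_minor (?U T - {r}) C) =
        (\<Sum>r\<in>?U T. p ^ ?l r (?U T) * a r s * set_minor (?U T - {r}) C)"
      using finT(1)[OF T] by (intro sum.UNION_disjoint[symmetric]) (auto simp: block_disjoint)
  qed
  also have "\<dots> \<approx> (\<Sum>T\<in>?S (Suc k). set_minor (?U T) (insert s C))"
  proof (rule cong_sum)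
    fix T assume T: "T \<in> ?S (Suc k)"
    have "finite (?U T)" using finT(1)[OF T] by simp
    then show "(\<Sum>r\<in>?U T. p ^ ?l r (?U T) * a r s * set_minor (?U T - {r}) C)
        \<approx> set_minor (?U T) (insert s C)"
      using C by (intro cong_sym[OF set_minor_expand_min])
  qed
  finally show ?thesis by (simp add: blocks_sum_def)
qed

end

section \<open>Minors as sums over permutations\<close>

fun list_inversions :: "nat list \<Rightarrow> nat" where
  "list_inversions [] = 0"
| "list_inversions (y # ys) = card {z\<in>set ys. z < y} + list_inversions ys"

text \<open>Inversions at position \<open>0\<close> are counted by the head of the list; the others
  are those of the tail, shifted by one.\<close>

lemma list_inversions_conv_card:
  assumes "distinct ys"
  shows "list_inversions ys = card {(i, j). i < j \<and> j < length ys \<and> ys ! i > ys ! j}"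
  using assms
proof (induction ys)
  case Nil
  then show ?case by simp
next
  case (Cons y ys)
  let ?J = "{j. j < length ys \<and> ys ! j < y}"
  let ?P = "{(i, j). i < j \<and> j < length ys \<and> ys ! i > ys ! j}"
  have "?P \<subseteq> {..<length ys} \<times> {..<length ys}" by auto
  then have fin: "finite ?P" by (rule finite_subset) simp
  have "{z\<in>set ys. z < y} = (!) ys ` ?J"
    by (auto simp: in_set_conv_nth)
  then have 1: "card {z\<in>set ys. z < y} = card ?J"
    using Cons.prems by (simp add: card_image inj_on_def nth_eq_iff_index_eq)
  have "{(i, j). i < j \<and> j < length (y # ys) \<and> (y # ys) ! i > (y # ys) ! j}
      = (\<lambda>j. (0::nat, Suc j)) ` ?J \<union> map_prod Suc Suc ` ?P"
  proof (intro equalityI subsetI)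
    fix x assume "x \<in> {(i, j). i < j \<and> j < length (y # ys) \<and> (y # ys) ! i > (y # ys) ! j}"
    then obtain i j where "x = (i, j)" "i < j" "j < length (y # ys)" "(y # ys) ! i > (y # ys) ! j"
      by auto
    then show "x \<in> (\<lambda>j. (0::nat, Suc j)) ` ?J \<union> map_prod Suc Suc ` ?P"
      by (cases i; cases j) (auto simp: image_iff)
  qed auto
  moreover have "card ((\<lambda>j. (0::nat, Suc j)) ` ?J) = card ?J" "card (map_prod Suc Suc ` ?P) = card ?P"
    by (auto intro!: card_image inj_onI)
  moreover have "card ((\<lambda>j. (0::nat, Suc j)) ` ?J \<union> map_prod Suc Suc ` ?P)
      = card ((\<lambda>j. (0::nat, Suc j)) ` ?J) + card (map_prod Suc Suc ` ?P)"
    using fin by (intro card_Un_disjoint) auto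
  ultimately have "card {(i, j). i < j \<and> j < length (y # ys) \<and> (y # ys) ! i > (y # ys) ! j}
      = card ?J + card ?P"
    by simp
  then show ?case using Cons 1 by simp
qed

text \<open>The first row chooses the first entry \<open>c\<close> of \<open>ys\<close>. The columns
  smaller than \<open>c\<close> are then the later entries smaller than \<open>c\<close>, so the
  exponents of all rows add up to \<open>list_inversions ys\<close>.\<close>

lemma row_minor_conv_permutations:
  fixes p :: "'r::ring_1"
  assumes central: "\<And>x. p * x = x * p" and "finite C" "length R = card C"
  shows "row_minor p a R C =
    (\<Sum>ys\<in>permutations_of_set C. p ^ list_inversions ys * prod_list (map2 a R ys))"
  using assms(2,3)
proof (induction R arbitrary: C)
  case Nil
  then show ?case by simp
next
  case (Cons i R)
  have pl: "a i c * (p ^ k * y) = p ^ k * (a i c * y)" for c k y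
    using power_commuting_commutes[OF central, of "k" "a i c"] by (simp flip: mult.assoc)
  have "C \<noteq> {}" using Cons.prems by auto
  have "row_minor p a (i # R) C = (\<Sum>c\<in>C. \<Sum>ys\<in>permutations_of_set (C - {c}).
      p ^ list_inversions (c # ys) * prod_list (map2 a (i # R) (c # ys)))"
    unfolding row_minor.simps row_mult_def
  proof (rule sum.cong[OF refl])
    fix c assume c: "c \<in> C"
    have "{z\<in>set ys. z < c} = {d\<in>C. d < c}" if "ys \<in> permutations_of_set (C - {c})" for ys
      using permutations_of_setD[OF that] by auto
    moreover have "length R = card (C - {c})" using Cons.prems c by simp
    ultimately show "p ^ card {d\<in>C. d < c} * a i c * row_minor p a R (C - {c}) =
      (\<Sum>ys\<in>permutations_of_set (C - {c}).
        p ^ list_inversions (c # ys) * prod_list (map2 a (i # R) (c # ys)))"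
      using Cons.prems
      by (subst Cons.IH) (simp_all add: sum_distrib_left power_add mult.assoc pl)
  qed
  also have "\<dots> = (\<Sum>ys\<in>permutations_of_set C.
      p ^ list_inversions ys * prod_list (map2 a (i # R) ys))"
    unfolding permutations_of_set_nonempty[OF \<open>C \<noteq> {}\<close>] using Cons.prems
    by (subst sum.UNION_disjoint) (auto simp: sum.reindex)
  finally show ?case .
qed

lemma bij_betw_permute_list:
  assumes "distinct xs"
  shows "bij_betw (\<lambda>\<sigma>. permute_list \<sigma> xs) {\<sigma>. \<sigma> permutes {0..<length xs}}
    (permutations_of_set (set xs))"
  unfolding bij_betw_def
proof (intro conjI inj_onI equalityI subsetI)
  fix \<sigma> \<tau> assume perm: "\<sigma> \<in> {\<sigma>. \<sigma> permutes {0..<length xs}}" "\<tau> \<in> {\<sigma>. \<sigma> permutes {0..<length xs}}"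
    and eq: "permute_list \<sigma> xs = permute_list \<tau> xs"
  show "\<sigma> = \<tau>"
  proof
    fix i
    show "\<sigma> i = \<tau> i"
    proof (cases "i < length xs")
      case True
      then have "xs ! \<sigma> i = xs ! \<tau> i"
        using eq perm permute_list_nth[of \<sigma> xs i] permute_list_nth[of \<tau> xs i]
        by (simp add: atLeast0LessThan)
      moreover have "\<sigma> i < length xs" "\<tau> i < length xs"
        using True perm permutes_in_image[of _ "{0..<length xs}" i] by auto
      ultimately show ?thesis using assms by (simp add: nth_eq_iff_index_eq)
    next
      case False
      then show ?thesis using perm by (auto simp: permutes_def)
    qed
  qed
next
  fix ys assume "ys \<in> (\<lambda>\<sigma>. permute_list \<sigma> xs) ` {\<sigma>. \<sigma> permutes {0..<length xs}}"
  then show "ys \<in> permutations_of_set (set xs)"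
    using assms by (auto simp: atLeast0LessThan intro!: permutations_of_setI)
next
  fix ys assume "ys \<in> permutations_of_set (set xs)"
  then have "mset ys = mset xs"
    using assms permutations_of_setD[of ys "set xs"] set_eq_iff_mset_eq_distinct[of ys xs] by simp
  then show "ys \<in> (\<lambda>\<sigma>. permute_list \<sigma> xs) ` {\<sigma>. \<sigma> permutes {0..<length xs}}"
    by (rule mset_eq_permutation) (auto simp: atLeast0LessThan)
qed

text \<open>Since \<open>cols\<close> is increasing, the inversions of the rearranged list are those
  of \<open>\<sigma>\<close>. This links the recursive minors to
  \<open>quantum_minor\<close>.\<close>

lemma row_minor_conv_permutes:
  fixes p :: "'r::ring_1"
  assumes central: "\<And>x. p * x = x * p" and cols: "sorted_wrt (<) cols" "length cols = length rows"
  shows "row_minor p a rows (set cols) = (\<Sum>\<sigma>\<in>{\<sigma>. \<sigma> permutes {0..<length rows}}.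
    p ^ inversion_number (length rows) \<sigma> *
    prod_list (map (\<lambda>r. a (rows ! r) (cols ! \<sigma> r)) [0..<length rows]))"
proof -
  let ?s = "length rows"
  have dist: "distinct cols" using cols by (simp add: strict_sorted_iff)
  have "row_minor p a rows (set cols) = (\<Sum>ys\<in>permutations_of_set (set cols).
      p ^ list_inversions ys * prod_list (map2 a rows ys))"
    using dist cols
    by (intro row_minor_conv_permutations central) (simp_all add: distinct_card)
  also have "\<dots> = (\<Sum>\<sigma>\<in>{\<sigma>. \<sigma> permutes {0..<?s}}.
      p ^ list_inversions (permute_list \<sigma> cols) * prod_list (map2 a rows (permute_list \<sigma> cols)))"
    using sum.reindex_bij_betw[OF bij_betw_permute_list[OF dist], symmetric] cols(2) by simp
  also have "\<dots> = (\<Sum>\<sigma>\<in>{\<sigma>. \<sigma> permutes {0..<?s}}. p ^ inversion_number ?s \<sigma> *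
      prod_list (map (\<lambda>r. a (rows ! r) (cols ! \<sigma> r)) [0..<?s]))"
  proof (rule sum.cong[OF refl])
    fix \<sigma> assume "\<sigma> \<in> {\<sigma>. \<sigma> permutes {0..<?s}}"
    then have \<sigma>: "\<sigma> permutes {..<length cols}" using cols by (simp add: atLeast0LessThan)
    have less: "\<sigma> i < length cols" if "i < length cols" for i
      using that permutes_in_image[OF \<sigma>, of i] by simp
    have mono: "cols ! i < cols ! j \<longleftrightarrow> i < j" if "i < length cols" "j < length cols" for i j
      using sorted_wrt_nth_less[OF cols(1), of i j] sorted_wrt_nth_less[OF cols(1), of j i] that
      by (cases i j rule: linorder_cases) auto
    have "list_inversions (permute_list \<sigma> cols) = inversion_number ?s \<sigma>"
      using dist \<sigma> cols(2) less mono
      by (subst list_inversions_conv_card)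
        (auto simp: inversion_number_def permute_list_nth intro!: arg_cong[of _ _ card])
    moreover have "map2 a rows (permute_list \<sigma> cols) = map (\<lambda>r. a (rows ! r) (cols ! \<sigma> r)) [0..<?s]"
      using \<sigma> cols(2) by (intro nth_equalityI) (simp_all add: permute_list_nth)
    ultimately show "p ^ list_inversions (permute_list \<sigma> cols) *
        prod_list (map2 a rows (permute_list \<sigma> cols)) =
      p ^ inversion_number ?s \<sigma> * prod_list (map (\<lambda>r. a (rows ! r) (cols ! \<sigma> r)) [0..<?s])"
      by simp
  qed
  finally show ?thesis .
qed

section \<open>The projection onto a presented algebra\<close>

text \<open>Scalars become constant polynomials, so that \<open>-q\<close> can serve as the central
  ring element \<open>p\<close>.\<close>

definition scalar :: "complex \<Rightarrow> 'x fword \<Rightarrow>\<^sub>0 complex" where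
  "scalar c = Poly_Mapping.single 0 c"

lemma scalar_simps:
  "scalar 0 = 0" "scalar 1 = 1" "scalar (c + d) = scalar c + scalar d"
  "scalar (c - d) = scalar c - scalar d" "scalar (- c) = - scalar c"
  "scalar (c * d) = scalar c * scalar d"
  by (simp_all add: scalar_def single_add single_diff single_uminus mult_single)

lemma scalar_power: "scalar (c ^ n) = scalar c ^ n"
  by (induction n) (simp_all add: scalar_simps)

lemma scalar_carrier [simp]: "scalar c \<in> carrier (free_algebra X)"
  by (simp add: scalar_def zero_fword_def)

lemma smult_free_algebra: "c \<odot>\<^bsub>free_algebra X\<^esub> f = scalar c * f"
  by (simp add: scalar_def mult_map_scale_conv_mult)

declare free_algebra_simps(1) [simp del]

text \<open>A constant sits on the empty word, which is neutral for concatenation, so it commutes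
  with monomials; the induction adds one monomial with a new word at a time.\<close>

lemma scalar_commute: "scalar c * f = f * scalar c"
proof (induction f rule: update_induct)
  case const
  then show ?case by simp
next
  case (update f k v)
  then have "Poly_Mapping.update k v f = f + Poly_Mapping.single k v"
    by (intro poly_mapping_eqI) (auto simp: lookup_update lookup_add lookup_single in_keys_iff)
  then show ?case
    using update by (simp add: distrib_left distrib_right scalar_def mult_single mult.commute)
qed

locale presented =
  fixes X :: "'x set" and R :: "('x fword \<Rightarrow>\<^sub>0 complex) set"
  assumes R_carrier: "R \<subseteq> carrier (free_algebra X)"
begin

abbreviation "F \<equiv> free_algebra X"
abbreviation "J \<equiv> genideal F R"
abbreviation "A \<equiv> presented_algebra X R"

text \<open>Computations are made with representatives, in a type of class \<open>ring_1\<close>,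
  and carried over to the quotient record by this projection.\<close>

definition \<pi> :: "('x fword \<Rightarrow>\<^sub>0 complex) \<Rightarrow> ('x fword \<Rightarrow>\<^sub>0 complex) set" where
  "\<pi> f = J +>\<^bsub>F\<^esub> f"

lemma ideal_J: "ideal J F"
  by (intro ring.genideal_ideal ring_free_algebra R_carrier)

sublocale J: ideal J F
  by (rule ideal_J)

lemma zero_J: "0 \<in> J"
  using additive_subgroup.zero_closed[OF J.additive_subgroup_axioms] by simp

lemma add_J: "f \<in> J \<Longrightarrow> g \<in> J \<Longrightarrow> f + g \<in> J"
  using additive_subgroup.a_closed[OF J.additive_subgroup_axioms] by simp

lemma J_uminus: "f \<in> J \<Longrightarrow> - f \<in> J"
proof -
  assume "f \<in> J"
  then have "scalar (- 1) * f \<in> J" using J.I_l_closed[of f "scalar (- 1)"] by simp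
  then show "- f \<in> J" by (simp add: scalar_simps)
qed

lemma in_coset_iff: "g \<in> \<pi> f \<longleftrightarrow> g - f \<in> J"
  by (auto simp: \<pi>_def a_r_coset_def' intro!: bexI[of _ "g - f"])

lemma \<pi>_eqI:
  assumes "f - g \<in> J"
  shows "\<pi> f = \<pi> g"
proof -
  have "h - f \<in> J \<longleftrightarrow> h - g \<in> J" for h
    using add_J[of "h - f" "f - g"] add_J[of "h - g" "- (f - g)"] assms J_uminus[OF assms] by auto
  then show ?thesis by (auto simp: in_coset_iff)
qed

lemma \<pi>_carrier: "f \<in> carrier F \<Longrightarrow> \<pi> f \<in> carrier A"
  by (auto simp: \<pi>_def presented_algebra_def quot_algebra_simps FactRing_simps
      simp del: free_algebra_simps)

lemma \<pi>_mult: "f \<in> carrier F \<Longrightarrow> g \<in> carrier F \<Longrightarrow> \<pi> f \<otimes>\<^bsub>A\<^esub> \<pi> g = \<pi> (f * g)"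
  using J.rcoset_mult_add[of f g] by (simp add: \<pi>_def presented_algebra_def quot_algebra_simps FactRing_def)

lemma \<pi>_add: "f \<in> carrier F \<Longrightarrow> g \<in> carrier F \<Longrightarrow> \<pi> f \<oplus>\<^bsub>A\<^esub> \<pi> g = \<pi> (f + g)"
  using J.a_rcos_sum[of f g] by (simp add: \<pi>_def presented_algebra_def quot_algebra_simps FactRing_def)

lemma \<pi>_one: "\<one>\<^bsub>A\<^esub> = \<pi> 1"
  by (simp add: \<pi>_def presented_algebra_def quot_algebra_simps FactRing_def)

lemma \<pi>_zero: "\<zero>\<^bsub>A\<^esub> = \<pi> 0"
  using zero_J
  by (auto simp: in_coset_iff presented_algebra_def quot_algebra_simps FactRing_def)

text \<open>The scalar multiple of a coset is a union over all its representatives; these all yield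
  the same coset.\<close>

lemma \<pi>_smult: "c \<odot>\<^bsub>A\<^esub> \<pi> f = \<pi> (scalar c * f)"
proof -
  have "\<pi> (scalar c * g) = \<pi> (scalar c * f)" if "g \<in> \<pi> f" for g
    using that J.I_l_closed[of "g - f" "scalar c"]
    by (intro \<pi>_eqI) (simp add: in_coset_iff right_diff_distrib)
  moreover have "f \<in> \<pi> f" using zero_J by (simp add: in_coset_iff)
  ultimately have "(\<Union>g\<in>\<pi> f. \<pi> (scalar c * g)) = \<pi> (scalar c * f)" by blast
  then show ?thesis
    by (simp add: presented_algebra_def quot_algebra_simps \<pi>_def smult_free_algebra
        del: free_algebra_simps)
qed

lemma ring_A: "ring A"
  unfolding presented_algebra_def by (intro ring_quot_algebra J.quotient_is_ring)

lemma sum_carrier: "(\<And>x. x \<in> S \<Longrightarrow> f x \<in> carrier F) \<Longrightarrow> sum f S \<in> carrier F"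
  by (induction S rule: infinite_finite_induct)
    (use scalar_carrier[of 0] in \<open>auto intro!: free_algebra_add_closed simp: scalar_simps\<close>)

lemma \<pi>_sum:
  assumes "finite S" "\<And>x. x \<in> S \<Longrightarrow> f x \<in> carrier F"
  shows "(\<Oplus>\<^bsub>A\<^esub>x\<in>S. \<pi> (f x)) = \<pi> (sum f S)"
  using assms
proof (induction S)
  case empty
  interpret A: ring A by (rule ring_A)
  show ?case by (simp add: \<pi>_zero)
next
  case (insert x S)
  interpret A: ring A by (rule ring_A)
  have "(\<Oplus>\<^bsub>A\<^esub>y\<in>insert x S. \<pi> (f y)) = \<pi> (f x) \<oplus>\<^bsub>A\<^esub> (\<Oplus>\<^bsub>A\<^esub>y\<in>S. \<pi> (f y))"
    using insert by (intro A.finsum_insert) (auto intro: \<pi>_carrier)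
  also have "\<dots> = \<pi> (f x) \<oplus>\<^bsub>A\<^esub> \<pi> (sum f S)" by (simp add: insert.IH insert.prems)
  also have "\<dots> = \<pi> (sum f (insert x S))"
    using insert by (subst \<pi>_add) (auto intro: sum_carrier)
  finally show ?case .
qed

lemma prod_list_carrier: "(\<And>x. x \<in> set xs \<Longrightarrow> f x \<in> carrier F) \<Longrightarrow> prod_list (map f xs) \<in> carrier F"
proof (induction xs)
  case Nil
  then show ?case using scalar_carrier[of 1] by (simp add: scalar_simps)
next
  case (Cons x xs)
  then show ?case by (auto intro: free_algebra_mult_closed)
qed

lemma \<pi>_prod_seq:
  "(\<And>x. x \<in> set xs \<Longrightarrow> f x \<in> carrier F) \<Longrightarrow> prod_seq A (map (\<lambda>x. \<pi> (f x)) xs) = \<pi> (prod_list (map f xs))"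
  by (induction xs)
    (simp_all add: prod_seq_def \<pi>_one \<pi>_mult prod_list_carrier)

lemma \<pi>_quantum_minor:
  assumes g: "\<And>i j. i \<in> set rows \<Longrightarrow> j \<in> set cols \<Longrightarrow> g i j \<in> carrier F"
    and a: "\<And>i j. i \<in> set rows \<Longrightarrow> j \<in> set cols \<Longrightarrow> a i j = \<pi> (g i j)"
    and cols: "sorted_wrt (<) cols" "length cols = length rows"
  shows "quantum_minor A q a rows cols = \<pi> (row_minor (scalar (- q)) g rows (set cols))"
proof -
  let ?s = "length rows"
  let ?P = "{\<sigma>. \<sigma> permutes {0..<?s}}"
  interpret A: ring A by (rule ring_A)
  have in_cols: "cols ! \<sigma> r \<in> set cols" if "\<sigma> \<in> ?P" "r < ?s" for \<sigma> r
    using that permutes_in_image[of \<sigma> "{0..<?s}" r] cols by auto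
  have carr: "prod_list (map (\<lambda>r. g (rows ! r) (cols ! \<sigma> r)) [0..<?s]) \<in> carrier F"
    if "\<sigma> \<in> ?P" for \<sigma>
    using that in_cols[OF that] by (intro prod_list_carrier g) auto
  have "quantum_minor A q a rows cols = (\<Oplus>\<^bsub>A\<^esub>\<sigma>\<in>?P. \<pi> (scalar (- q) ^ inversion_number ?s \<sigma> *
      prod_list (map (\<lambda>r. g (rows ! r) (cols ! \<sigma> r)) [0..<?s])))"
    unfolding quantum_minor_def Let_def
  proof (rule A.add.finprod_cong'[OF refl])
    fix \<sigma> assume \<sigma>: "\<sigma> \<in> ?P"
    have "map (\<lambda>r. a (rows ! r) (cols ! \<sigma> r)) [0..<?s] =
        map (\<lambda>r. \<pi> (g (rows ! r) (cols ! \<sigma> r))) [0..<?s]"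
      using in_cols[OF \<sigma>] by (auto intro!: a)
    moreover have "prod_seq A (map (\<lambda>r. \<pi> (g (rows ! r) (cols ! \<sigma> r))) [0..<?s]) =
        \<pi> (prod_list (map (\<lambda>r. g (rows ! r) (cols ! \<sigma> r)) [0..<?s]))"
      using in_cols[OF \<sigma>] by (intro \<pi>_prod_seq g) auto
    ultimately have "prod_seq A (map (\<lambda>r. a (rows ! r) (cols ! \<sigma> r)) [0..<?s]) =
        \<pi> (prod_list (map (\<lambda>r. g (rows ! r) (cols ! \<sigma> r)) [0..<?s]))"
      by (simp only:)
    then show "(- q) ^ inversion_number ?s \<sigma> \<odot>\<^bsub>A\<^esub>
          prod_seq A (map (\<lambda>r. a (rows ! r) (cols ! \<sigma> r)) [0..<?s]) =
        \<pi> (scalar (- q) ^ inversion_number ?s \<sigma> *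
          prod_list (map (\<lambda>r. g (rows ! r) (cols ! \<sigma> r)) [0..<?s]))"
      by (simp add: \<pi>_smult scalar_power)
  next
    show "(\<lambda>\<sigma>. \<pi> (scalar (- q) ^ inversion_number ?s \<sigma> *
        prod_list (map (\<lambda>r. g (rows ! r) (cols ! \<sigma> r)) [0..<?s]))) \<in> ?P \<rightarrow> carrier A"
      using carr by (auto simp flip: scalar_power
          intro!: \<pi>_carrier free_algebra_mult_closed)
  qed
  also have "\<dots> = \<pi> (\<Sum>\<sigma>\<in>?P. scalar (- q) ^ inversion_number ?s \<sigma> *
      prod_list (map (\<lambda>r. g (rows ! r) (cols ! \<sigma> r)) [0..<?s]))"
    using carr by (intro \<pi>_sum) (auto simp flip: scalar_power
          intro!: free_algebra_mult_closed finite_permutations)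
  also have "\<dots> = \<pi> (row_minor (scalar (- q)) g rows (set cols))"
    by (simp only: row_minor_conv_permutes[OF scalar_commute cols])
  finally show ?thesis .
qed

end

section \<open>Hyper-Pfaffians in the quantum matrix algebra\<close>

definition entry :: "nat \<Rightarrow> nat \<Rightarrow> nat \<Rightarrow> (nat \<times> nat) fword \<Rightarrow>\<^sub>0 complex" where
  "entry N i j = (if i \<in> {1..N} \<and> j \<in> {1..N} then free_gen (i, j) else 0)"

text \<open>It is applied to the map from positions to entries of an increasing list, which turns
  exponents given by positions into exponents given by columns.\<close>

lemma inversions_image:
  assumes "strict_mono_on D g" "X \<subseteq> D" "Y \<subseteq> D"
  shows "inversions (g ` X) (g ` Y) = inversions X Y"
proof -
  have inj: "inj_on g D" by (rule strict_mono_on_imp_inj_on[OF assms(1)])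
  have "inversions (g ` X) (g ` Y) = (\<Sum>x\<in>X. card {y\<in>g ` Y. y < g x})"
    unfolding inversions_def using inj assms(2) by (subst sum.reindex) (auto intro: inj_on_subset)
  also have "\<dots> = (\<Sum>x\<in>X. card {y\<in>Y. y < x})"
  proof (rule sum.cong[OF refl])
    fix x assume "x \<in> X"
    have "g y < g x \<longleftrightarrow> y < x" if "y \<in> Y" for y
      using strict_mono_on_less[OF assms(1), of y x] that \<open>x \<in> X\<close> assms(2,3) by auto
    then have "{y\<in>g ` Y. y < g x} = g ` {y\<in>Y. y < x}" by auto
    then show "card {y\<in>g ` Y. y < g x} = card {y\<in>Y. y < x}"
      using inj assms(3) by (metis (no_types, lifting) card_image inj_on_subset mem_Collect_eq subsetI)
  qed
  finally show ?thesis by (simp add: inversions_def)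
qed

text \<open>Of the \<open>j\<^sub>t - 2\<close> positions from \<open>2\<close> to
  \<open>j\<^sub>t - 1\<close>, exactly \<open>t - 2\<close> are chosen, namely the earlier entries
  of \<open>js\<close>. So \<open>j\<^sub>t - t\<close> counts the omitted ones; in the proof
  \<open>i = t - 2\<close>.\<close>

lemma bracket_exponent:
  assumes "js \<in> bracket_positions m L"
  shows "(\<Sum>t = 2..m. js ! (t - 2) - t) = inversions (set js) ({2..L} - set js)"
proof -
  have js: "length js = m - 1" "sorted_wrt (<) js" "set js \<subseteq> {2..L}"
    using assms by (auto simp: bracket_positions_def)
  have dist: "distinct js" using js by (simp add: strict_sorted_iff)
  have card: "card {d\<in>{2..L} - set js. d < js ! i} = js ! i - (i + 2)" if i: "i < length js" for i
  proof -
    have "js ! i \<in> {2..L}" using js(3) nth_mem[OF i] by blast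
    then have "{d\<in>{2..L} - set js. d < js ! i} = {2..<js ! i} - {d\<in>set js. d < js ! i}" by auto
    moreover have "{d\<in>set js. d < js ! i} = (!) js ` {..<i}"
    proof -
      have "js ! a < js ! i \<longleftrightarrow> a < i" if "a < length js" for a
        using sorted_wrt_nth_less[OF js(2), of a i] sorted_wrt_nth_less[OF js(2), of i a] that i
        by (cases a i rule: linorder_cases) auto
      then show ?thesis using i by (auto simp: set_conv_nth)
    qed
    moreover have "card ((!) js ` {..<i}) = i"
      using dist i by (subst card_image) (auto simp: inj_on_def nth_eq_iff_index_eq)
    moreover have "{d\<in>set js. d < js ! i} \<subseteq> {2..<js ! i}" using js(3) by auto
    ultimately show ?thesis by (simp add: card_Diff_subset)
  qed
  have "(\<Sum>t = 2..m. js ! (t - 2) - t) = (\<Sum>i<length js. js ! i - (i + 2))"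
    by (rule sum.reindex_bij_witness[of _ "\<lambda>i. i + 2" "\<lambda>t. t - 2"]) (auto simp: js)
  also have "\<dots> = (\<Sum>i<length js. card {d\<in>{2..L} - set js. d < js ! i})"
    using card by (intro sum.cong) auto
  also have "\<dots> = inversions (set js) ({2..L} - set js)"
    unfolding inversions_def by (rule sum.reindex_bij_betw[OF bij_betw_nth]) (auto simp: dist)
  finally show ?thesis .
qed

text \<open>An increasing list is determined by its set, and \<open>g\<close> carries sets of
  positions to sets of columns.\<close>

lemma sum_bracket_positions:
  assumes "L \<ge> 1" "bij_betw g {2..L} C"
  shows "(\<Sum>js\<in>bracket_positions m L. f (g ` set js)) = (\<Sum>I\<in>{I. I \<subseteq> C \<and> card I = m - 1}. f I)"
proof (rule sum.reindex_bij_witness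
    [where i = "\<lambda>I. sorted_list_of_set {j\<in>{2..L}. g j \<in> I}" and j = "\<lambda>js. g ` set js"])
  have inj: "inj_on g {2..L}" and im: "g ` {2..L} = C"
    using assms(2) by (auto simp: bij_betw_def)
  {
    fix js assume "js \<in> bracket_positions m L"
    then have js: "length js = m - 1" "sorted_wrt (<) js" "set js \<subseteq> {2..L}"
      by (auto simp: bracket_positions_def)
    have "g j \<in> g ` set js \<longleftrightarrow> j \<in> set js" if "j \<in> {2..L}" for j
      using inj_on_image_mem_iff[OF inj that js(3)] .
    then have "{j\<in>{2..L}. g j \<in> g ` set js} = set js" using js(3) by blast
    then show "sorted_list_of_set {j\<in>{2..L}. g j \<in> g ` set js} = js"
      using js(2) by (simp add: sorted_list_of_set.idem_if_sorted_distinct strict_sorted_iff)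
    have "card (g ` set js) = m - 1"
      using js inj by (simp add: card_image inj_on_subset distinct_card strict_sorted_iff)
    then show "g ` set js \<in> {I. I \<subseteq> C \<and> card I = m - 1}"
      using js(3) im by auto
  next
    fix I assume "I \<in> {I. I \<subseteq> C \<and> card I = m - 1}"
    then have I: "I \<subseteq> C" "card I = m - 1" by auto
    have gI: "g ` {j\<in>{2..L}. g j \<in> I} = I" using I im by auto
    then show "g ` set (sorted_list_of_set {j\<in>{2..L}. g j \<in> I}) = I" by simp
    have "card {j\<in>{2..L}. g j \<in> I} = m - 1"
      using card_image[of g "{j\<in>{2..L}. g j \<in> I}"] gI I(2) inj
      by (metis (no_types, lifting) inj_on_subset mem_Collect_eq subsetI)
    then show "sorted_list_of_set {j\<in>{2..L}. g j \<in> I} \<in> bracket_positions m L"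
      by (auto simp: bracket_positions_def)
  }
qed auto

declare One_nat_def [simp del]

section \<open>The quantum matrix algebra as an instance of the abstract relations\<close>

locale quantum_matrix =
  fixes q :: complex and N :: nat
  assumes q_nonzero: "q \<noteq> 0"
begin

sublocale presented "{1..N} \<times> {1..N}" "qmat_relations q N"
  by unfold_locales (rule qmat_relations_carrier)

lemma entry_carrier: "entry N i j \<in> carrier F"
  by (auto simp: entry_def free_gen_def free_algebra_simps(1))

lemma relation_J: "r \<in> qmat_relations q N \<Longrightarrow> r \<in> J"
  using ring.genideal_self[OF ring_free_algebra qmat_relations_carrier] by blast

sublocale quantum_matrix_mod "carrier F" J "scalar (- q)" "scalar (- inverse q)" "entry N"
proof
  show "0 \<in> carrier F" "1 \<in> carrier F"
    using scalar_carrier[of 0] scalar_carrier[of 1] by (simp_all add: scalar_simps)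
  show "x + y \<in> carrier F" "x * y \<in> carrier F" if "x \<in> carrier F" "y \<in> carrier F" for x y
    using that by (simp_all add: free_algebra_add_closed free_algebra_mult_closed)
  show "x * y \<in> J" "y * x \<in> J" if "x \<in> carrier F" "y \<in> J" for x y
    using that J.I_l_closed[of y x] J.I_r_closed[of y x] by simp_all
  show "scalar (- q) * scalar (- inverse q) = 1"
    using q_nonzero by (simp flip: scalar_simps)
  \<comment> \<open>In this and the next two relations an index outside the matrix puts a factor
    \<open>0\<close> into every product; otherwise the relation is a defining one.\<close>
  show "entry N i k * entry N i l + scalar (- q) * (entry N i l * entry N i k) \<in> J" if "k < l" for i k l
  proof (cases "i \<in> {1..N} \<and> k \<in> {1..N} \<and> l \<in> {1..N}")
    case True
    then have "free_gen (i, k) * free_gen (i, l) - scalar q * (free_gen (i, l) * free_gen (i, k))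
        \<in> qmat_relations q N"
      using that unfolding qmat_relations_def Let_def smult_free_algebra by blast
    then show ?thesis using True relation_J by (simp add: entry_def scalar_simps)
  qed (use zero_J in \<open>auto simp: entry_def\<close>)
  show "entry N j k * entry N i l - entry N i l * entry N j k \<in> J" if "i < j" "k < l" for i j k l
  proof (cases "i \<in> {1..N} \<and> j \<in> {1..N} \<and> k \<in> {1..N} \<and> l \<in> {1..N}")
    case True
    then have "free_gen (j, k) * free_gen (i, l) - free_gen (i, l) * free_gen (j, k)
        \<in> qmat_relations q N"
      using that unfolding qmat_relations_def Let_def smult_free_algebra by blast
    then show ?thesis using True relation_J by (simp add: entry_def)
  qed (use zero_J in \<open>auto simp: entry_def\<close>)
  \<comment> \<open>The plus sign is due to \<open>p - p' = -(q - inverse q)\<close>.\<close>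
  show "entry N i k * entry N j l - entry N j l * entry N i k +
      (scalar (- q) - scalar (- inverse q)) * (entry N i l * entry N j k) \<in> J"
    if "i < j" "k < l" for i j k l
  proof (cases "i \<in> {1..N} \<and> j \<in> {1..N} \<and> k \<in> {1..N} \<and> l \<in> {1..N}")
    case True
    then have "free_gen (i, k) * free_gen (j, l) - free_gen (j, l) * free_gen (i, k)
        - scalar (q - inverse q) * (free_gen (i, l) * free_gen (j, k)) \<in> qmat_relations q N"
      using that unfolding qmat_relations_def Let_def smult_free_algebra by blast
    then have "free_gen (i, k) * free_gen (j, l) - free_gen (j, l) * free_gen (i, k)
        - scalar (q - inverse q) * (free_gen (i, l) * free_gen (j, k)) \<in> J"
      by (rule relation_J)
    also have "free_gen (i, k) * free_gen (j, l) - free_gen (j, l) * free_gen (i, k)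
        - scalar (q - inverse q) * (free_gen (i, l) * free_gen (j, k)) =
      entry N i k * entry N j l - entry N j l * entry N i k +
      (scalar (- q) - scalar (- inverse q)) * (entry N i l * entry N j k)"
      using True by (simp add: entry_def scalar_simps algebra_simps)
    finally show ?thesis .
  qed (use zero_J in \<open>auto simp: entry_def\<close>)
qed (simp_all add: zero_J add_J J_uminus entry_carrier scalar_commute)

lemma \<pi>_cong: "cong x y \<Longrightarrow> \<pi> x = \<pi> y"
  by (simp add: cong_def \<pi>_eqI)

lemma quantum_minor_eq:
  assumes "set rows \<subseteq> {1..N}" "set cols \<subseteq> {1..N}" "sorted_wrt (<) cols" "length cols = length rows"
  shows "quantum_minor A q (qmat_gen q N) rows cols =
    \<pi> (row_minor (scalar (- q)) (entry N) rows (set cols))"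
proof (rule \<pi>_quantum_minor)
  fix i j assume "i \<in> set rows" "j \<in> set cols"
  then have "i \<in> {1..N}" "j \<in> {1..N}" using assms by auto
  then show "qmat_gen q N i j = \<pi> (entry N i j)"
    by (simp add: entry_def qmat_gen_def presented_gen_def \<pi>_def)
qed (use assms entry_carrier in auto)

text \<open>The recursion passes to sublists of columns, so \<open>s\<close> varies in the
  induction, while the supply of \<open>n\<close> blocks stays fixed.\<close>

lemma hyper_bracket_eq:
  assumes m: "m \<ge> 2" and q: "(- q) ^ (m * (m - 1)) = (- q) ^ m"
    and b: "\<And>I. sorted_wrt (<) I \<Longrightarrow> set I \<subseteq> {1..N} \<Longrightarrow> length I = m \<Longrightarrow>
      b I = \<pi> (block_sum m n (set I))"
    and s: "sorted_wrt (<) s" "set s \<subseteq> {1..N}" "length s = m * Suc k"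
  shows "hyper_bracket A q m b (Suc k) s = \<pi> (blocks_sum m n (Suc k) (set s))"
  using s
proof (induction k arbitrary: s)
  case 0
  then show ?case by (simp add: b blocks_sum_1)
next
  case (Suc k)
  let ?L = "m * Suc (Suc k)"
  let ?g = "\<lambda>j. s ! (j - 1)"
  let ?P = "bracket_positions m ?L"
  interpret A: ring A by (rule ring_A)
  \<comment> \<open>Position \<open>1\<close> always goes to the first factor and holds the least
    column \<open>s0\<close>; the positions from \<open>2\<close> on hold the columns
    \<open>C\<close>.\<close>
  define s0 where "s0 = s ! 0"
  define C where "C = ?g ` {2..?L}"
  have L: "?L \<ge> 2" using m by simp
  have mono: "strict_mono_on {1..?L} ?g"
    using sorted_wrt_nth_less[OF Suc.prems(1)] Suc.prems(3) by (auto simp: strict_mono_on_def)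
  have sub2: "{2..?L} \<subseteq> {1..?L}" by auto
  have inj: "inj_on ?g {1..?L}" by (rule strict_mono_on_imp_inj_on[OF mono])
  then have bij: "bij_betw ?g {2..?L} C"
    using inj_on_subset[OF _ sub2] by (simp add: bij_betw_def C_def)
  have finC: "finite C" by (simp add: C_def)
  have "{0..<length s} = (\<lambda>j. j - 1) ` {1..?L}"
    using Suc.prems(3) by (auto simp: image_iff intro!: bexI[of _ "Suc _"])
  moreover have "set s = (!) s ` {0..<length s}"
    by (auto simp: set_conv_nth)
  ultimately have sets: "set s = ?g ` {1..?L}"
    by (simp only: image_image)
  have ivl: "{1..?L} = insert 1 {2..?L}" using L by auto
  have set_s: "set s = insert s0 C"
    unfolding sets ivl C_def s0_def by simp
  have s0_less: "\<forall>c\<in>C. s0 < c"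
  proof
    fix c assume "c \<in> C"
    then obtain j where "j \<in> {2..?L}" "c = ?g j" by (auto simp: C_def)
    then show "s0 < c" using strict_mono_onD[OF mono, of 1 j] by (simp add: s0_def)
  qed
  have card_C: "card C = ?L - 1"
    using bij_betw_same_card[OF bij] by simp
  have term_eq: "(- q) ^ (\<Sum>t = 2..m. js ! (t - 2) - t) \<odot>\<^bsub>A\<^esub>
        (b (map ?g (1 # js)) \<otimes>\<^bsub>A\<^esub>
         hyper_bracket A q m b (Suc k) (nths s {i. Suc i \<notin> set (1 # js)})) =
      \<pi> (scalar (- q) ^ inversions (?g ` set js) (C - ?g ` set js) *
        block_sum m n (insert s0 (?g ` set js)) * blocks_sum m n (Suc k) (C - ?g ` set js))"
    if js_in: "js \<in> ?P" for js
  proof -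
    have js: "length js = m - 1" "sorted_wrt (<) js" "set js \<subseteq> {2..?L}"
      using js_in by (auto simp: bracket_positions_def)
    have exp: "(\<Sum>t = 2..m. js ! (t - 2) - t) = inversions (?g ` set js) (C - ?g ` set js)"
    proof -
      have "C - ?g ` set js = ?g ` ({2..?L} - set js)"
        unfolding C_def using js(3) sub2
        by (intro inj_on_image_set_diff[OF inj, symmetric]) auto
      moreover have "set js \<subseteq> {1..?L}" "{2..?L} - set js \<subseteq> {1..?L}" using js(3) sub2 by blast+
      ultimately show ?thesis
        by (simp only: bracket_exponent[OF js_in] inversions_image[OF mono])
    qed
    have "b (map ?g (1 # js)) = \<pi> (block_sum m n (insert s0 (?g ` set js)))"
    proof -
      have "sorted_wrt (<) (1 # js)" and sub: "set (1 # js) \<subseteq> {1..?L}" using js(2,3) L by auto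
      then have "sorted_wrt (<) (map ?g (1 # js))"
        unfolding sorted_wrt_map
        by (elim sorted_wrt_mono_rel[rotated]) (use sub in \<open>blast intro: strict_mono_onD[OF mono]\<close>)
      moreover have "set (map ?g (1 # js)) = insert s0 (?g ` set js)" by (simp add: s0_def)
      moreover have "insert s0 (?g ` set js) \<subseteq> {1..N}"
        using Suc.prems(2) js(3) unfolding set_s C_def by blast
      ultimately show ?thesis using b[of "map ?g (1 # js)"] js(1) m by simp
    qed
    moreover have "hyper_bracket A q m b (Suc k) (nths s {i. Suc i \<notin> set (1 # js)}) =
        \<pi> (blocks_sum m n (Suc k) (C - ?g ` set js))"
    proof -
      let ?r = "nths s {i. Suc i \<notin> set (1 # js)}"
      have sorted: "sorted_wrt (<) ?r"
        using Suc.prems(1) sorted_nths distinct_nthsI by (auto simp: strict_sorted_iff)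
      have "set ?r = ?g ` ({1..?L} - set (1 # js))"
      proof -
        have "set ?r = (\<lambda>i. s ! i) ` {i. i < ?L \<and> Suc i \<notin> set (1 # js)}"
          using Suc.prems(3) by (auto simp: set_nths)
        also have "{i. i < ?L \<and> Suc i \<notin> set (1 # js)} = (\<lambda>j. j - 1) ` ({1..?L} - set (1 # js))"
          by (force simp: image_iff intro!: bexI[of _ "Suc _"])
        finally show ?thesis by (simp add: image_image)
      qed
      also have "{1..?L} - set (1 # js) = {2..?L} - set js" by auto
      also have "?g ` \<dots> = C - ?g ` set js"
        unfolding C_def using js(3) sub2
        by (intro inj_on_image_set_diff[OF inj]) auto
      finally have set_r: "set ?r = C - ?g ` set js" .
      have "inj_on ?g (set js)"
        using js(3) bij by (auto simp: bij_betw_def intro: inj_on_subset)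
      then have "card (?g ` set js) = m - 1"
        using js by (simp add: card_image distinct_card strict_sorted_iff)
      moreover have "?g ` set js \<subseteq> C" using js(3) by (auto simp: C_def)
      ultimately have "card (set ?r) = (?L - 1) - (m - 1)"
        unfolding set_r using finC by (simp add: card_Diff_subset finite_subset card_C)
      then have "length ?r = m * Suc k"
        using sorted m distinct_card[of ?r] by (simp add: strict_sorted_iff)
      moreover have "set ?r \<subseteq> {1..N}" using Suc.prems(2) unfolding set_r set_s by auto
      ultimately show ?thesis using Suc.IH[OF sorted] by (simp only: set_r)
    qed
    ultimately show ?thesis
      by (simp add: exp \<pi>_mult \<pi>_smult scalar_power mult.assoc)
  qed
  have carr: "scalar (- q) ^ inversions I (C - I) * block_sum m n (insert s0 I) *
      blocks_sum m n (Suc k) (C - I) \<in> carrier F" for I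
    by (intro mult_K) auto
  have finP: "finite ?P"
    by (rule finite_subset[OF _ finite_lists_length_eq[of "{..?L}" "m - 1"]])
      (auto simp: bracket_positions_def)
  have "hyper_bracket A q m b (Suc (Suc k)) s =
    (\<Oplus>\<^bsub>A\<^esub>js\<in>?P. \<pi> (scalar (- q) ^ inversions (?g ` set js) (C - ?g ` set js) *
        block_sum m n (insert s0 (?g ` set js)) * blocks_sum m n (Suc k) (C - ?g ` set js)))"
    unfolding hyper_bracket.simps
    by (intro A.add.finprod_cong') (auto simp: term_eq[simplified] intro!: \<pi>_carrier carr)
  also have "\<dots> = \<pi> (\<Sum>js\<in>?P. scalar (- q) ^ inversions (?g ` set js) (C - ?g ` set js) *
        block_sum m n (insert s0 (?g ` set js)) * blocks_sum m n (Suc k) (C - ?g ` set js))"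
    by (rule \<pi>_sum[OF finP carr])
  also have "(\<Sum>js\<in>?P. scalar (- q) ^ inversions (?g ` set js) (C - ?g ` set js) *
        block_sum m n (insert s0 (?g ` set js)) * blocks_sum m n (Suc k) (C - ?g ` set js)) =
    (\<Sum>I\<in>{I. I \<subseteq> C \<and> card I = m - 1}. scalar (- q) ^ inversions I (C - I) *
        block_sum m n (insert s0 I) * blocks_sum m n (Suc k) (C - I))"
    using L by (intro sum_bracket_positions[OF _ bij]) simp
  \<comment> \<open>Subsets of any other size contribute \<open>0\<close> by degree, which brings
    the sum into the form of \<open>blocks_sum_Suc\<close>.\<close>
  also have "\<dots> = (\<Sum>I\<in>Pow C. scalar (- q) ^ inversions I (C - I) *
        block_sum m n (insert s0 I) * blocks_sum m n (Suc k) (C - I))"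
  proof (rule sum.mono_neutral_left)
    show "\<forall>I\<in>Pow C - {I. I \<subseteq> C \<and> card I = m - 1}. scalar (- q) ^ inversions I (C - I) *
        block_sum m n (insert s0 I) * blocks_sum m n (Suc k) (C - I) = 0"
    proof
      fix I assume I: "I \<in> Pow C - {I. I \<subseteq> C \<and> card I = m - 1}"
      then have "finite I" "s0 \<notin> I" using finC s0_less finite_subset by auto
      then have "card (insert s0 I) \<noteq> m" using I by auto
      then show "scalar (- q) ^ inversions I (C - I) *
        block_sum m n (insert s0 I) * blocks_sum m n (Suc k) (C - I) = 0"
        using \<open>finite I\<close> by (simp add: block_sum_eq_0)
    qed
  qed (use finC in auto)
  also have "\<pi> \<dots> = \<pi> (blocks_sum m n (Suc (Suc k)) (set s))"
    unfolding set_s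
    by (intro \<pi>_cong blocks_sum_Suc m finC s0_less) (simp only: q flip: scalar_power)
  finally show ?case .
qed

end

theorem theorem3p5:
  fixes k m n :: nat and q :: complex
  assumes "k \<ge> 1" and "m = 2 * k" and "n \<ge> 1"
    and "q \<noteq> 0" and "q ^ (8 * (k choose 2)) = 1"
  shows
    "let A = qmat_algebra q (m * n);
         a = qmat_gen q (m * n);
         b = (\<lambda>I. \<Oplus>\<^bsub>A\<^esub> i \<in> {1..n}. quantum_minor A q a [m * (i - 1) + 1..<Suc (m * i)] I)
     in quantum_hyper_pfaffian A q m n b = quantum_det A q a (m * n)"
proof -
  interpret quantum_matrix q "m * n"
    using assms by unfold_locales
  interpret A: ring A by (rule ring_A)
  define b where "b = (\<lambda>I. \<Oplus>\<^bsub>A\<^esub> i \<in> {1..n}.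
    quantum_minor A q (qmat_gen q (m * n)) [m * (i - 1) + 1..<Suc (m * i)] I)"
  have m: "m \<ge> 2" using assms by simp
  have "m * (m - 1) = 8 * (k choose 2) + m"
  proof -
    have "even (k * (k - 1))" by (cases "even k") auto
    then have "2 * (k choose 2) = k * (k - 1)" by (simp only: choose_two dvd_mult_div_cancel)
    then have "8 * (k choose 2) = 4 * k * (k - 1)" by simp
    then show ?thesis using assms(1,2) by (cases k) (simp_all add: algebra_simps)
  qed
  \<comment> \<open>The exponent \<open>8 * (k choose 2)\<close> is even, so the assumption on
    \<open>q\<close> holds for \<open>-q\<close> as well.\<close>
  then have q: "(- q) ^ (m * (m - 1)) = (- q) ^ m"
    using assms(5) by (simp add: power_add)
  have b: "b I = \<pi> (block_sum m n (set I))"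
    if I: "sorted_wrt (<) I" "set I \<subseteq> {1..m * n}" "length I = m" for I
  proof -
    have "quantum_minor A q (qmat_gen q (m * n)) [m * (i - 1) + 1..<Suc (m * i)] I =
      \<pi> (set_minor (block m i) (set I))" if i: "i \<in> {1..n}" for i
    proof -
      have le: "m * i \<le> m * n" using i by simp
      have "set [m * (i - 1) + 1..<Suc (m * i)] \<subseteq> {1..m * n}"
      proof
        fix x assume "x \<in> set [m * (i - 1) + 1..<Suc (m * i)]"
        then have "1 \<le> x" "x \<le> m * i" by (simp_all del: upt_Suc)
        then show "x \<in> {1..m * n}" using order_trans[OF _ le] by simp
      qed
      moreover have "length [m * (i - 1) + 1..<Suc (m * i)] = m"
        using i by (cases i) (auto simp del: upt_Suc)
      ultimately show ?thesis
        unfolding block_def sorted_list_of_set_range using I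
        by (intro quantum_minor_eq) simp_all
    qed
    then have "b I = (\<Oplus>\<^bsub>A\<^esub>i\<in>{1..n}. \<pi> (set_minor (block m i) (set I)))"
      unfolding b_def by (intro A.add.finprod_cong') (auto intro!: \<pi>_carrier)
    then show ?thesis by (simp add: \<pi>_sum block_sum_def)
  qed
  obtain n' where n': "n = Suc n'" using assms(3) by (cases n) auto
  have "hyper_bracket A q m b (Suc n') [1..<Suc (m * n)] =
      \<pi> (blocks_sum m n (Suc n') (set [1..<Suc (m * n)]))"
    by (rule hyper_bracket_eq[OF m q b]) (auto simp: sorted_wrt_upt n' simp del: upt_Suc)
  then have "quantum_hyper_pfaffian A q m n b = \<pi> (blocks_sum m n n (set [1..<Suc (m * n)]))"
    by (simp only: quantum_hyper_pfaffian_def n'[symmetric])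
  \<comment> \<open>Choosing \<open>n\<close> of the \<open>n\<close> blocks leaves a single
    product, that over all rows.\<close>
  also have "\<dots> = quantum_det A q (qmat_gen q (m * n)) (m * n)"
    unfolding blocks_sum_all quantum_det_def
    by (intro quantum_minor_eq[symmetric]) (auto simp del: upt_Suc)
  finally show ?thesis
    by (simp only: Let_def b_def qmat_algebra_def)
qed

end
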